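(* Consider a Pontryagin extremal (controlled extremal lifted trajectory) $(g,X,\Lambda_1,\Lambda_R,\lambda_{cost},u)$ of the Reinhardt control problem on a compact interval $[t_1,t_2]$ that does not meet the singular locus $\mathcal S_{sing}$. Assume that the trajectory $(g,X)$ is also edge-extremal. Then the control function is bang-bang with finitely many switches: $u$ is equal almost everywhere to a piecewise constant function with finitely many pieces taking values in the vertex set of $U_T$.
   Context: Notation: $\langle X,Y\rangle=\mathrm{trace}(XY)$, $[X,Y]=XY-YX$ on $\mathfrak{sl}_2(\mathbb R)$; $J=\begin{pmatrix}0&-1\\ 1&0\end{pmatrix}$, $R=\exp(J\pi/3)$; $U_T=\{(u_0,u_1,u_2):u_i\ge0,\sum u_i=1\}$; $Z_u=\begin{pmatrix}\frac{u_1-u_2}{\sqrt3}&\frac{u_0-2u_1-2u_2}{3}\\ u_0&\frac{u_2-u_1}{\sqrt3}\end{pmatrix}$; $\Phi(x+iy)=\begin{pmatrix}x/y&-(x^2+y^2)/y\\ 1/y&-x/y\end{pmatrix}$; $\mathfrak h^\star=\{x+iy:y>0,|x|<1/\sqrt3,x^2+y^2>1/3\}$. A Pontryagin extremal (lifted extremal trajectory) on an interval consists of a measurable control $u$ with values in $U_T$, absolutely continuous $g$ in $\mathrm{SL}_2(\mathbb R)$, $X=\Phi(z)$ with $z$ in $\mathfrak h^\star$, $\Lambda_1,\Lambda_R$ in $\mathfrak{sl}_2(\mathbb R)$ with $\langle\Lambda_R,X\rangle=0$, and a constant $\lambda_{cost}\le0$, with $(\lambda_{cost},\Lambda_1(t),\Lambda_R(t))\ne0$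 for all $t$, such that, with $P=Z_u/\langle Z_u,X\rangle$, $$g'=gX,\quad X'=[P,X],\quad \Lambda_1'=[\Lambda_1,X],\quad \Lambda_R'=[P,\Lambda_R]-\langle\Lambda_R,P\rangle[P,X]+[-\Lambda_1+\tfrac32\lambda_{cost}J,X],$$ and such that for almost every $t$ the Hamiltonian $\mathcal H(v)=\langle\Lambda_1-\frac32\lambda_{cost}J,X\rangle-\frac{\langle\Lambda_R,Z_v\rangle}{\langle X,Z_v\rangle}$ is maximized over $v\in U_T$ at $v=u(t)$ with maximal value $0$. Singular locus: $\mathcal S_{sing}=\{(g,\Lambda_1,X,\Lambda_R)=(g_0,\frac32\lambda_{cost}J,J,0): g_0\in\mathrm{SL}_2(\mathbb R),\ \lambda_{cost}\neq0\}$. Edge control problem (for the edge $u_0=0$): write $u=(0,\frac12+u_e,\frac12-u_e)$ with $u_e\in[-\frac12,\frac12]$ and $X=\Phi(x+iy)$. State variables $(s,x,y)$ with $y>0$, $|x|<1/\sqrt3$; state equations $s'=1/y$, $x'=y$, $y'=f_2(x,y,u_e)=\frac{2\sqrt3y^2u_e}{-1+2\sqrt3xu_e}$; fixed endpoint values of $(s,x,y)$, free terminal time; cost $\int x^2/y\,dt$; Hamiltonian $\lambda_1y+\lambda_2f_2+\lambda_3/y+\lambda_{cost}x^2/y$. (Here $s(t)=\int dt/y$, and $(s,x,y)$ determines $g$ up to a constant left factor.) A trajectory of it is extremal if there are a constant $\lambda_{cost}\le0$ and absolutely continuous $\lambda_1,\lambda_2,\lambda_3$, with $(\lambda_1,\lambda_2,\lambda_3,\lambda_{cost})$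 nowhere zero, satisfying $\lambda_1'=-\partial_x\mathcal H$, $\lambda_2'=-\partial_y\mathcal H$, $\lambda_3'=-\partial_s\mathcal H=0$, with $u_e(t)$ maximizing the Hamiltonian over $[-\frac12,\frac12]$ almost everywhere and with maximal value $0$. The edge problems for the other two edges of $U_T$ are obtained by rotation: the transformation $g\mapsto RgR^{-1}$, $X\mapsto RXR^{-1}$, $Z_u\mapsto RZ_uR^{-1}=Z_{R\cdot u}$ permutes the vertices by $(0,0,1)\mapsto(0,1,0)\mapsto(1,0,0)\mapsto(0,0,1)$. A trajectory $(g,X)$ with control $u=(u_0,u_1,u_2)$ is edge-extremal if on every subinterval of its domain on which some component $u_j$ is zero almost everywhere, the trajectory is extremal for the corresponding edge control problem. *)

theory Defs
  imports "HOL-Analysis.Analysis"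
begin

type_synonym mat2 = "real^2^2"

abbreviation mat22 :: "real \<Rightarrow> real \<Rightarrow> real \<Rightarrow> real \<Rightarrow> mat2" where
  "mat22 a b c d \<equiv> vector [vector [a, b], vector [c, d]]"

definition tform :: "mat2 \<Rightarrow> mat2 \<Rightarrow> real" where
  "tform X Y = trace (X ** Y)"

definition bracket :: "mat2 \<Rightarrow> mat2 \<Rightarrow> mat2" where
  "bracket X Y = X ** Y - Y ** X"

definition SL2 :: "mat2 set" where
  "SL2 = {A. det A = 1}"

definition sl2 :: "mat2 set" where
  "sl2 = {A. trace A = 0}"

definition Jmat :: mat2 where
  "Jmat = mat22 0 (-1) 1 0"

text \<open>The class function \<^const>\<open>exp\<close> would use the componentwise product on \<^typ>\<open>mat2\<close>.\<close>

definition mat_exp :: "mat2 \<Rightarrow> mat2" where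
  "mat_exp A = (\<Sum>n. (1 / fact n) *\<^sub>R (((**) A) ^^ n) (mat 1))"

definition Rmat :: mat2 where
  "Rmat = mat_exp ((pi / 3) *\<^sub>R Jmat)"

definition conjR :: "mat2 \<Rightarrow> mat2" where
  "conjR A = Rmat ** A ** matrix_inv Rmat"


type_synonym ctrl = "real \<times> real \<times> real"

definition UT :: "ctrl set" where
  "UT = {(u0, u1, u2). u0 \<ge> 0 \<and> u1 \<ge> 0 \<and> u2 \<ge> 0 \<and> u0 + u1 + u2 = 1}"

definition UT_vertices :: "ctrl set" where
  "UT_vertices = {(1, 0, 0), (0, 1, 0), (0, 0, 1)}"

fun Zmat :: "ctrl \<Rightarrow> mat2" where
  "Zmat (u0, u1, u2) =
     mat22 ((u1 - u2) / sqrt 3) ((u0 - 2 * u1 - 2 * u2) / 3) u0 ((u2 - u1) / sqrt 3)"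

text \<open>The linear action of \<open>R\<close> on controls, determined by its effect on the three vertices;
  see \<open>conjR_Zmat\<close> below.\<close>

fun ctrl_rot :: "ctrl \<Rightarrow> ctrl" where
  "ctrl_rot (u0, u1, u2) = (u1, u2, u0)"

definition Phi :: "complex \<Rightarrow> mat2" where
  "Phi z = mat22 (Re z / Im z) (- ((Re z)\<^sup>2 + (Im z)\<^sup>2) / Im z) (1 / Im z) (- Re z / Im z)"

definition hstar :: "complex set" where
  "hstar = {z. Im z > 0 \<and> \<bar>Re z\<bar> < 1 / sqrt 3 \<and> (Re z)\<^sup>2 + (Im z)\<^sup>2 > 1 / 3}"


text \<open>Absolute continuity on \<open>[a,b]\<close>: the \<open>\<epsilon>\<close>-\<open>\<delta>\<close> condition over finite families \<open>D\<close> of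
  non-overlapping compact subintervals. (The library's \<^const>\<open>absolutely_continuous\<close> is about
  measures.)\<close>

definition abs_cont_on :: "real \<Rightarrow> real \<Rightarrow> (real \<Rightarrow> 'a::real_normed_vector) \<Rightarrow> bool" where
  "abs_cont_on a b f \<longleftrightarrow>
     (\<forall>\<epsilon>>0. \<exists>\<delta>>0. \<forall>D. D division_of \<Union>D \<and> \<Union>D \<subseteq> {a..b} \<and> (\<Sum>K\<in>D. measure lborel K) < \<delta>
        \<longrightarrow> (\<Sum>K\<in>D. norm (f (Sup K) - f (Inf K))) < \<epsilon>)"

text \<open>\<open>x' = F\<close> almost everywhere, for absolutely continuous \<open>x\<close>.\<close>

definition solves_on :: "real \<Rightarrow> real \<Rightarrow> (real \<Rightarrow> 'a::real_normed_vector) \<Rightarrow> (real \<Rightarrow> 'a) \<Rightarrow> bool" where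
  "solves_on a b x F \<longleftrightarrow>
     abs_cont_on a b x \<and>
     (AE t in lebesgue_on {a..b}. (x has_vector_derivative F t) (at t within {a..b}))"


definition Pctrl :: "mat2 \<Rightarrow> ctrl \<Rightarrow> mat2" where
  "Pctrl X u = (1 / tform (Zmat u) X) *\<^sub>R Zmat u"

definition Ham :: "real \<Rightarrow> mat2 \<Rightarrow> mat2 \<Rightarrow> mat2 \<Rightarrow> ctrl \<Rightarrow> real" where
  "Ham lc L1 X LR v =
     tform (L1 - (3 / 2 * lc) *\<^sub>R Jmat) X - tform LR (Zmat v) / tform X (Zmat v)"

definition pontryagin_extremal ::
  "real \<Rightarrow> real \<Rightarrow> (real \<Rightarrow> mat2) \<Rightarrow> (real \<Rightarrow> mat2) \<Rightarrow> (real \<Rightarrow> mat2) \<Rightarrow> (real \<Rightarrow> mat2)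
     \<Rightarrow> real \<Rightarrow> (real \<Rightarrow> ctrl) \<Rightarrow> bool" where
  "pontryagin_extremal a b g X L1 LR lc u \<longleftrightarrow>
     u \<in> borel_measurable (lebesgue_on {a..b}) \<and>
     (\<forall>t\<in>{a..b}. u t \<in> UT \<and> g t \<in> SL2 \<and> X t \<in> Phi ` hstar \<and> L1 t \<in> sl2 \<and> LR t \<in> sl2
        \<and> tform (LR t) (X t) = 0 \<and> (lc, L1 t, LR t) \<noteq> 0) \<and>
     lc \<le> 0 \<and>
     solves_on a b g (\<lambda>t. g t ** X t) \<and>
     solves_on a b X (\<lambda>t. bracket (Pctrl (X t) (u t)) (X t)) \<and>
     solves_on a b L1 (\<lambda>t. bracket (L1 t) (X t)) \<and>
     solves_on a b LR (\<lambda>t. let P = Pctrl (X t) (u t) in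
        bracket P (LR t) - tform (LR t) P *\<^sub>R bracket P (X t)
          + bracket (- L1 t + (3 / 2 * lc) *\<^sub>R Jmat) (X t)) \<and>
     (AE t in lebesgue_on {a..b}.
        (\<forall>v\<in>UT. Ham lc (L1 t) (X t) (LR t) v \<le> Ham lc (L1 t) (X t) (LR t) (u t)) \<and>
        Ham lc (L1 t) (X t) (LR t) (u t) = 0)"

text \<open>Elements are quadruples \<open>(g, \<Lambda>\<^sub>1, X, \<Lambda>\<^sub>R)\<close>.\<close>

definition sing_locus :: "(mat2 \<times> mat2 \<times> mat2 \<times> mat2) set" where
  "sing_locus = {(g0, (3 / 2 * lc) *\<^sub>R Jmat, Jmat, 0) | g0 lc. g0 \<in> SL2 \<and> lc \<noteq> 0}"


definition edge_f2 :: "real \<Rightarrow> real \<Rightarrow> real \<Rightarrow> real" where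
  "edge_f2 x y v = 2 * sqrt 3 * y\<^sup>2 * v / (- 1 + 2 * sqrt 3 * x * v)"

definition edge_Ham :: "real \<Rightarrow> real \<Rightarrow> real \<Rightarrow> real \<Rightarrow> real \<Rightarrow> real \<Rightarrow> real \<Rightarrow> real \<Rightarrow> real" where
  "edge_Ham l1 l2 l3 lc s x y v = l1 * y + l2 * edge_f2 x y v + l3 / y + lc * x\<^sup>2 / y"

definition edge_problem_extremal ::
  "real \<Rightarrow> real \<Rightarrow> (real \<Rightarrow> real) \<Rightarrow> (real \<Rightarrow> real) \<Rightarrow> (real \<Rightarrow> real) \<Rightarrow> (real \<Rightarrow> real) \<Rightarrow> bool" where
  "edge_problem_extremal a b s x y v \<longleftrightarrow>
     v \<in> borel_measurable (lebesgue_on {a..b}) \<and>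
     (\<forall>t\<in>{a..b}. v t \<in> {-1/2..1/2} \<and> y t > 0 \<and> \<bar>x t\<bar> < 1 / sqrt 3) \<and>
     solves_on a b s (\<lambda>t. 1 / y t) \<and>
     solves_on a b x y \<and>
     solves_on a b y (\<lambda>t. edge_f2 (x t) (y t) (v t)) \<and>
     (\<exists>lc l1 l2 l3. lc \<le> 0 \<and>
        (\<forall>t\<in>{a..b}. (l1 t, l2 t, l3 t, lc) \<noteq> 0) \<and>
        solves_on a b l1
          (\<lambda>t. - deriv (\<lambda>\<xi>. edge_Ham (l1 t) (l2 t) (l3 t) lc (s t) \<xi> (y t) (v t)) (x t)) \<and>
        solves_on a b l2
          (\<lambda>t. - deriv (\<lambda>\<eta>. edge_Ham (l1 t) (l2 t) (l3 t) lc (s t) (x t) \<eta> (v t)) (y t)) \<and>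
        solves_on a b l3
          (\<lambda>t. - deriv (\<lambda>\<sigma>. edge_Ham (l1 t) (l2 t) (l3 t) lc \<sigma> (x t) (y t) (v t)) (s t)) \<and>
        (AE t in lebesgue_on {a..b}.
           (\<forall>w\<in>{-1/2..1/2}. edge_Ham (l1 t) (l2 t) (l3 t) lc (s t) (x t) (y t) w
              \<le> edge_Ham (l1 t) (l2 t) (l3 t) lc (s t) (x t) (y t) (v t)) \<and>
           edge_Ham (l1 t) (l2 t) (l3 t) lc (s t) (x t) (y t) (v t) = 0))"

text \<open>Extremality on \<open>[a,b]\<close> for the edge \<open>u\<^sub>0 = 0\<close>. The functions \<open>x\<close>, \<open>y\<close> are determined by \<open>X\<close>,
  and \<open>s\<close> by \<open>X\<close> up to an additive constant; \<open>g\<close> is recovered from \<open>X\<close> up to a constant left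
  factor and does not enter.\<close>

definition edge0_extremal :: "real \<Rightarrow> real \<Rightarrow> (real \<Rightarrow> mat2) \<Rightarrow> (real \<Rightarrow> ctrl) \<Rightarrow> bool" where
  "edge0_extremal a b X u \<longleftrightarrow>
     (\<exists>s x y ue. (\<forall>t\<in>{a..b}. X t = Phi (Complex (x t) (y t))) \<and>
        (AE t in lebesgue_on {a..b}. u t = (0, 1/2 + ue t, 1/2 - ue t)) \<and>
        edge_problem_extremal a b s x y ue)"

text \<open>The first component of \<open>(ctrl_rot ^^ j) u\<close> is \<open>u\<^sub>j\<close> for \<open>j < 3\<close>, so rotating \<open>j\<close> times carries
  the edge \<open>u\<^sub>j = 0\<close> to the edge \<open>u\<^sub>0 = 0\<close>.\<close>

definition edge_extremal :: "real \<Rightarrow> real \<Rightarrow> (real \<Rightarrow> mat2) \<Rightarrow> (real \<Rightarrow> ctrl) \<Rightarrow> bool" where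
  "edge_extremal t1 t2 X u \<longleftrightarrow>
     (\<forall>a b. \<forall>j<3. t1 \<le> a \<and> a < b \<and> b \<le> t2 \<and>
        (AE t in lebesgue_on {a..b}. fst ((ctrl_rot ^^ j) (u t)) = 0)
        \<longrightarrow> edge0_extremal a b (\<lambda>t. (conjR ^^ j) (X t)) (\<lambda>t. (ctrl_rot ^^ j) (u t)))"


definition piecewise_const_on :: "real \<Rightarrow> real \<Rightarrow> (real \<Rightarrow> 'a) \<Rightarrow> bool" where
  "piecewise_const_on a b w \<longleftrightarrow>
     (\<exists>(n::nat) \<tau>. \<tau> 0 = a \<and> \<tau> n = b \<and> (\<forall>i<n. \<tau> i < \<tau> (Suc i)) \<and>
        (\<forall>i<n. \<exists>c. \<forall>t\<in>{\<tau> i<..<\<tau> (Suc i)}. w t = c))"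


lemma mat2_eq_iff: "(A::mat2) = B \<longleftrightarrow> A$1$1 = B$1$1 \<and> A$1$2 = B$1$2 \<and> A$2$1 = B$2$1 \<and> A$2$2 = B$2$2"
  by (auto simp: vec_eq_iff forall_2)

lemma Rmat_eq: "Rmat = mat22 (1 / 2) (- sqrt 3 / 2) (sqrt 3 / 2) (1 / 2)"
proof -
  define h :: "complex \<Rightarrow> mat2" where "h = (\<lambda>z. Re z *\<^sub>R mat 1 + Im z *\<^sub>R Jmat)"
  have bl: "bounded_linear h"
    unfolding h_def
    by (intro bounded_linear_add bounded_linear_compose[OF bounded_linear_scaleR_left]
        bounded_linear_Re bounded_linear_Im)
  have mult: "h (z * w) = h z ** h w" for z w
    by (simp add: h_def mat2_eq_iff matrix_matrix_mult_def sum_2 Jmat_def mat_def algebra_simps)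
  have pow: "h (z ^ n) = (((**) (h z)) ^^ n) (mat 1)" for z n
    by (induction n) (simp_all add: mult, simp add: h_def)
  have "(\<lambda>n. h (z ^ n /\<^sub>R fact n)) sums h (exp z)" for z
    by (rule bounded_linear.sums[OF bl exp_converges])
  then have "(\<lambda>n. (1 / fact n) *\<^sub>R (((**) (h z)) ^^ n) (mat 1)) sums h (exp z)" for z
    by (simp add: linear_cmul[OF bounded_linear.linear[OF bl]] pow inverse_eq_divide)
  then have "mat_exp (h z) = h (exp z)" for z
    unfolding mat_exp_def by (simp add: sums_iff)
  from this[of "\<i> * (pi / 3)"] have "Rmat = h (cis (pi / 3))"
    by (simp add: Rmat_def h_def cis_conv_exp)
  then show ?thesis
    by (simp add: h_def mat2_eq_iff Jmat_def mat_def cos_60 sin_60)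
qed

lemma matrix_inv_Rmat: "matrix_inv Rmat = mat22 (1 / 2) (sqrt 3 / 2) (- sqrt 3 / 2) (1 / 2)"
  (is "_ = ?B")
proof -
  have inv: "Rmat ** ?B = mat 1" "?B ** Rmat = mat 1"
    by (simp_all add: Rmat_eq mat2_eq_iff matrix_matrix_mult_def sum_2 mat_def)
  then have "Rmat ** matrix_inv Rmat = mat 1 \<and> matrix_inv Rmat ** Rmat = mat 1"
    unfolding matrix_inv_def by (rule someI[where P = "\<lambda>A. Rmat ** A = mat 1 \<and> A ** Rmat = mat 1", OF conjI])
  then have "matrix_inv Rmat = (?B ** Rmat) ** matrix_inv Rmat" "?B = ?B ** (Rmat ** matrix_inv Rmat)"
    by (simp_all only: inv matrix_mul_lid matrix_mul_rid)
  then show ?thesis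
    by (simp only: matrix_mul_assoc)
qed

lemma conjR_Zmat: "conjR (Zmat u) = Zmat (ctrl_rot u)"
proof (cases u)
  case (fields u0 u1 u2)
  have [simp]: "sqrt 3 * (sqrt 3 * c) = 3 * c" "(sqrt 3)\<^sup>2 = 3" for c :: real
    by (simp_all flip: mult.assoc)
  show ?thesis
    unfolding fields conjR_def matrix_inv_Rmat unfolding Rmat_eq
    by (simp add: mat2_eq_iff matrix_matrix_mult_def sum_2 field_simps)
qed

end

theory Submission
  imports Defs
begin

text \<open>
  Up to an additive constant the Hamiltonian is minus a weighted mean of the three switching functions
  \<open>A\<^sub>j = \<langle>\<Lambda>\<^sub>R,Z\<^sub>j\<rangle> / \<langle>X,Z\<^sub>j\<rangle>\<close> with weights \<open>u\<^sub>j \<langle>X,Z\<^sub>j\<rangle> / \<langle>X,Z\<^sub>u\<rangle>\<close>, so \<open>u\<^sub>j = 0\<close> almost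
  everywhere on an interval where \<open>A\<^sub>j\<close> is not minimal. Near every time \<open>t\<^sub>0\<close> one has
  \<open>\<Lambda>\<^sub>R(t) = (t - t\<^sub>0)\<^sup>k (W + o(1))\<close> with \<open>k \<le> 2\<close> and \<open>0 \<noteq> W \<bottom> X(t\<^sub>0)\<close>: with \<open>M = \<Lambda>\<^sub>1 - (3/2) \<lambda> J\<close>, where \<open>\<lambda>\<close> is the
  cost multiplier, one takes \<open>W = \<Lambda>\<^sub>R\<close> if \<open>\<Lambda>\<^sub>R \<noteq> 0\<close>, \<open>W = -[M,X]\<close> if \<open>\<Lambda>\<^sub>R = 0 \<noteq> M\<close>, and \<open>W = -[[\<Lambda>\<^sub>1,X],X]/2\<close> if
  \<open>\<Lambda>\<^sub>R = M = 0\<close>, which is nonzero off the singular locus. The numbers \<open>\<langle>W,Z\<^sub>j\<rangle> / \<langle>X,Z\<^sub>j\<rangle>\<close> are not all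
  equal, so some \<open>A\<^sub>j\<close> is not minimal on each side of \<open>t\<^sub>0\<close>, and the trajectory is there governed by an
  edge problem.

  For the edge problem, eliminating \<open>\<lambda>\<^sub>1\<close> by means of \<open>H = 0\<close> gives \<open>(\<lambda>\<^sub>2 y)' = 2 (\<lambda>\<^sub>3 + \<lambda> x\<^sup>2) / y\<close>, with
  constant \<open>\<lambda>\<^sub>3\<close> and strictly increasing \<open>x\<close>; hence the zeros of \<open>\<lambda>\<^sub>2\<close>, the only possible switching
  times, are isolated. Compactness of \<open>[t\<^sub>1,t\<^sub>2]\<close> makes the number of switches finite.
\<close>

section \<open>Absolutely continuous solutions\<close>

lemma AE_lebesgue_on_iff_negligible:
  "(AE t in lebesgue_on {a..b::real}. P t) \<longleftrightarrow> negligible {t\<in>{a..b}. \<not> P t}"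
proof -
  have "(AE t in lebesgue_on {a..b}. P t) \<longleftrightarrow> (AE t in lebesgue. t \<in> {a..b} \<longrightarrow> P t)"
    by (rule AE_restrict_space_iff) auto
  also have "\<dots> \<longleftrightarrow> negligible {t\<in>{a..b}. \<not> P t}"
    by (simp add: negligible_iff_null_sets completion.AE_iff_null_sets)
  finally show ?thesis .
qed

lemma AE_lebesgue_on_subinterval:
  assumes "AE t in lebesgue_on {a..b::real}. P t" "a \<le> c" "d \<le> b"
  shows "AE t in lebesgue_on {c..d}. P t"
  using assms unfolding AE_lebesgue_on_iff_negligible
  by (elim negligible_subset) auto

lemma abs_cont_on_subinterval:
  assumes "abs_cont_on a b f" "a \<le> c" "d \<le> b"
  shows "abs_cont_on c d f"
  unfolding abs_cont_on_def
proof (intro allI impI)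
  fix \<epsilon> :: real assume "\<epsilon> > 0"
  then obtain \<delta> where \<delta>: "\<delta> > 0" "\<And>D. D division_of \<Union>D \<and> \<Union>D \<subseteq> {a..b} \<and> (\<Sum>K\<in>D. measure lborel K) < \<delta>
        \<Longrightarrow> (\<Sum>K\<in>D. norm (f (Sup K) - f (Inf K))) < \<epsilon>"
    using assms(1) unfolding abs_cont_on_def by metis
  have "{c..d} \<subseteq> {a..b}" using assms by auto
  with \<delta> show "\<exists>\<delta>>0. \<forall>D. D division_of \<Union>D \<and> \<Union>D \<subseteq> {c..d} \<and> (\<Sum>K\<in>D. measure lborel K) < \<delta>
        \<longrightarrow> (\<Sum>K\<in>D. norm (f (Sup K) - f (Inf K))) < \<epsilon>"
    by (meson subset_trans)
qed

lemma solves_on_subinterval: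
  assumes "solves_on a b f F" "a \<le> c" "d \<le> b"
  shows "solves_on c d f F"
proof -
  have "AE t in lebesgue_on {c..d}. (f has_vector_derivative F t) (at t within {a..b})"
    using assms AE_lebesgue_on_subinterval unfolding solves_on_def by blast
  then have "AE t in lebesgue_on {c..d}. (f has_vector_derivative F t) (at t within {c..d})"
    by (rule AE_mp) (use assms in \<open>auto intro!: AE_I2 elim!: has_vector_derivative_within_subset\<close>)
  then show ?thesis
    using assms abs_cont_on_subinterval unfolding solves_on_def by blast
qed

text \<open>Intervals tagged in the exceptional null set are confined to an open set of small measure,
  where absolute continuity applies.\<close>

lemma solves_on_has_integral:
  fixes f :: "real \<Rightarrow> 'a::banach"
  assumes "solves_on a b f F" and "a \<le> b"
  shows "(F has_integral f b - f a) {a..b}"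
proof -
  define N where "N = {t\<in>{a..b}. \<not> (f has_vector_derivative F t) (at t within {a..b})}"
  have N: "negligible N"
    using assms(1) by (simp add: solves_on_def AE_lebesgue_on_iff_negligible N_def)
  \<comment> \<open>A tag in N then contributes nothing to the Riemann sum, so for such tags only
    the increments of f remain to be bounded.\<close>
  define F0 where "F0 = (\<lambda>t. if t \<in> N then 0 else F t)"
  have "(F0 has_integral f b - f a) {a..b}"
    unfolding has_integral_real
  proof (intro allI impI)
    fix e :: real assume "e > 0"
    \<comment> \<open>The errors at tags outside N add up to at most e' (b - a) \<le> e / 2; the
      summand 1 keeps the denominator positive when a = b.\<close>
    define e' where "e' = e / (2 * (b - a + 1))"
    have "e' > 0" using \<open>e > 0\<close> \<open>a \<le> b\<close> by (simp add: e'_def)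
    have e': "e' * (b - a) \<le> e / 2"
      using \<open>e > 0\<close> \<open>a \<le> b\<close> by (simp add: e'_def field_simps)
    obtain \<delta> where \<delta>: "\<delta> > 0"
      "\<And>D. D division_of \<Union>D \<and> \<Union>D \<subseteq> {a..b} \<and> (\<Sum>K\<in>D. measure lborel K) < \<delta>
        \<Longrightarrow> (\<Sum>K\<in>D. norm (f (Sup K) - f (Inf K))) < e / 2"
      using assms(1) half_gt_zero[OF \<open>e > 0\<close>] unfolding solves_on_def abs_cont_on_def by metis
    have "N \<in> sets lebesgue" using N by (simp add: negligible_imp_sets)
    then obtain U where U: "open U" "N \<subseteq> U" "U - N \<in> lmeasurable" "emeasure lebesgue (U - N) < ennreal \<delta>"
      using sets_lebesgue_outer_open \<open>\<delta> > 0\<close> by metis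
    have "N \<in> lmeasurable" using N by (simp add: negligible_imp_measurable)
    then have Um: "U \<in> lmeasurable"
      using U by (metis Un_Diff_cancel2 Un_absorb2 fmeasurable.Un)
    have "measure lebesgue U = measure lebesgue (U - N)"
      using N Um by (simp add: measure_Diff_null_set negligible_iff_null_sets fmeasurableD)
    also have "\<dots> < \<delta>"
      using U(3,4) by (simp add: emeasure_eq_measure2 ennreal_less_iff)
    finally have mU: "measure lebesgue U < \<delta>" .
    have "\<forall>x. \<exists>d>0. (x \<in> {a..b} - N \<longrightarrow>
         (\<forall>y\<in>{a..b}. norm (y-x) < d \<longrightarrow> norm (f y - f x - (y-x) *\<^sub>R F x) \<le> e' * norm (y-x)))
         \<and> (x \<in> N \<longrightarrow> ball x d \<subseteq> U)"
    proof
      fix x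
      show "\<exists>d>0. (x \<in> {a..b} - N \<longrightarrow>
         (\<forall>y\<in>{a..b}. norm (y-x) < d \<longrightarrow> norm (f y - f x - (y-x) *\<^sub>R F x) \<le> e' * norm (y-x)))
         \<and> (x \<in> N \<longrightarrow> ball x d \<subseteq> U)"
      proof (cases "x \<in> N")
        case True
        then show ?thesis using U(1,2) by (metis DiffD2 openE subsetD)
      next
        case False
        then have "x \<in> {a..b} \<Longrightarrow> (f has_vector_derivative F x) (at x within {a..b})"
          by (auto simp: N_def)
        then show ?thesis
          using \<open>e' > 0\<close> False unfolding has_vector_derivative_def has_derivative_within_alt
          by (cases "x \<in> {a..b}") (auto intro: exI[of _ 1])
      qed
    qed
    then obtain d where d: "\<And>x. 0 < d x"
       "\<And>x y. \<lbrakk>x \<in> {a..b} - N; y \<in> {a..b}; norm (y-x) < d x\<rbrakk>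
          \<Longrightarrow> norm (f y - f x - (y-x) *\<^sub>R F x) \<le> e' * norm (y-x)"
       "\<And>x. x \<in> N \<Longrightarrow> ball x (d x) \<subseteq> U"
      by metis
    have "norm ((\<Sum>(x, K)\<in>p. measure lborel K *\<^sub>R F0 x) - (f b - f a)) < e"
      if ptag: "p tagged_division_of {a..b}" and fine: "(\<lambda>x. ball x (d x)) fine p" for p
    proof -
      \<comment> \<open>The intervals tagged in N lie in U, so their total length is below \<delta>
        and absolute continuity bounds their increments by e / 2.\<close>
      define q where "q = {xK\<in>p. fst xK \<in> N}"
      define D where "D = snd ` q"
      have fin: "finite p" using ptag by blast
      have ba: "b - a = (\<Sum>(x,K)\<in>p. Sup K - Inf K)" "f b - f a = (\<Sum>(x,K)\<in>p. f(Sup K) - f(Inf K))"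
        using additive_tagged_division_1[where f= "\<lambda>x. x"] additive_tagged_division_1[where f= f]
            \<open>a \<le> b\<close> ptag by auto
      have qpart: "q tagged_partial_division_of {a..b}"
        using tagged_partial_division_subset[of p "{a..b}" q] ptag
        by (auto simp: q_def tagged_division_of_def)
      have Ddiv: "D division_of \<Union>D"
        unfolding D_def by (rule partial_division_of_tagged_division[OF qpart])
      have Dsub: "\<Union>D \<subseteq> {a..b}"
        using qpart unfolding D_def tagged_partial_division_of_def by fastforce
      have DU: "\<Union>D \<subseteq> U"
        using fine d(3) unfolding D_def q_def fine_def by fastforce
      have "(\<Sum>K\<in>D. measure lborel K) = (\<Sum>K\<in>D. measure lebesgue K)"
        using Ddiv by (intro sum.cong) (auto simp: division_of_def)
      also have "\<dots> = measure lebesgue (\<Union>D)"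
        using content_division[OF Ddiv] by simp
      also have "\<dots> \<le> measure lebesgue U"
        using Ddiv DU Um lmeasurable_division[OF Ddiv] by (intro measure_mono_fmeasurable) auto
      finally have "(\<Sum>K\<in>D. norm (f (Sup K) - f (Inf K))) < e / 2"
        using \<delta>(2)[of D] Ddiv Dsub mU by linarith
      moreover have "(\<Sum>(x,K)\<in>q. norm (f (Sup K) - f (Inf K))) = (\<Sum>K\<in>D. norm (f (Sup K) - f (Inf K)))"
      proof -
        \<comment> \<open>Several tags may share a degenerate interval, so replacing the sum over q
          by a sum over D needs a summand that vanishes on all degenerate boxes, the empty one
          included.\<close>
        define h where "h = (\<lambda>K. if K = {} then 0 else norm (f (Sup K) - f (Inf K)))"
        have "(\<Sum>(x,K)\<in>q. norm (f (Sup K) - f (Inf K))) = (\<Sum>(x,K)\<in>q. h K)"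
          using qpart unfolding h_def tagged_partial_division_of_def by (intro sum.cong) fastforce+
        also have "\<dots> = (\<Sum>K\<in>D. h K)"
          unfolding D_def
        proof (rule sum.over_tagged_division_lemma)
          show "q tagged_division_of \<Union>(snd ` q)"
            by (rule tagged_partial_division_of_Union_self[OF qpart])
          show "h (cbox u v) = 0" if "box u v = {}" for u v
            using that by (cases "u = v") (auto simp: h_def)
        qed
        also have "\<dots> = (\<Sum>K\<in>D. norm (f (Sup K) - f (Inf K)))"
          using Ddiv by (intro sum.cong) (auto simp: h_def division_of_def)
        finally show ?thesis .
      qed
      ultimately have bad: "(\<Sum>(x,K)\<in>q. norm (f (Sup K) - f (Inf K))) < e / 2" by simp
      have "norm (\<Sum>(x, K)\<in>p. measure lborel K *\<^sub>R F0 x - (f (Sup K) - f (Inf K)))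
          \<le> (\<Sum>(x,K)\<in>p. e' * (Sup K - Inf K) + (if x \<in> N then norm (f (Sup K) - f (Inf K)) else 0))"
      proof (rule sum_norm_le, safe)
        fix x K
        assume xK: "(x, K) \<in> p"
        then have "x \<in> K" and kab: "K \<subseteq> {a..b}"
          using ptag by blast+
        then obtain u v where k: "K = {u..v}"
          using ptag xK by (metis box_real(2) tagged_division_ofD(4))
        have "u \<le> v" using \<open>x \<in> K\<close> unfolding k by auto
        have ball: "\<forall>y\<in>K. y \<in> ball x (d x)"
          using fine xK by blast
        have "u \<in> K" "v \<in> K"
          by (simp_all add: \<open>u \<le> v\<close> k)
        show "norm (measure lborel K *\<^sub>R F0 x - (f (Sup K) - f (Inf K)))
          \<le> e' * (Sup K - Inf K) + (if x \<in> N then norm (f (Sup K) - f (Inf K)) else 0)"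
        proof (cases "x \<in> N")
          case True
          then show ?thesis using \<open>e' > 0\<close> \<open>u \<le> v\<close> by (simp add: F0_def k norm_minus_commute)
        next
          case False
          have "norm ((v - u) *\<^sub>R F x - (f v - f u)) = norm (f u - f x - (u - x) *\<^sub>R F x - (f v - f x - (v - x) *\<^sub>R F x))"
            by (auto simp: algebra_simps)
          also have "\<dots> \<le> norm (f u - f x - (u - x) *\<^sub>R F x) + norm (f v - f x - (v - x) *\<^sub>R F x)"
            by (rule norm_triangle_ineq4)
          also have "\<dots> \<le> e' * norm (u - x) + e' * norm (v - x)"
            using False \<open>x \<in> K\<close> \<open>u \<in> K\<close> \<open>v \<in> K\<close> kab ball
            by (intro add_mono d(2)) (auto simp: dist_real_def abs_minus_commute)
          also have "\<dots> \<le> e' * (v - u)"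
            using \<open>x \<in> K\<close> by (auto simp: k field_simps)
          finally show ?thesis
            using False \<open>u \<le> v\<close> by (simp add: k F0_def)
        qed
      qed
      also have "\<dots> = e' * (b - a) + (\<Sum>(x,K)\<in>p. if x \<in> N then norm (f (Sup K) - f (Inf K)) else 0)"
        by (simp add: ba(1) split_def sum.distrib sum_distrib_left)
      also have "(\<Sum>(x,K)\<in>p. if x \<in> N then norm (f (Sup K) - f (Inf K)) else 0)
          = (\<Sum>(x,K)\<in>q. norm (f (Sup K) - f (Inf K)))"
        unfolding q_def split_def by (simp add: sum.inter_filter[OF fin])
      finally show ?thesis
        using bad e' by (simp add: ba(2) split_def sum_subtractf)
    qed
    then show "\<exists>\<gamma>. gauge \<gamma> \<and> (\<forall>\<D>. \<D> tagged_division_of {a..b} \<and> \<gamma> fine \<D> \<longrightarrow>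
        norm ((\<Sum>(x,k)\<in>\<D>. measure lborel k *\<^sub>R F0 x) - (f b - f a)) < e)"
      using d(1) gauge_ball_dependent by blast
  qed
  then show ?thesis
    by (rule has_integral_spike[OF N, rotated]) (simp add: F0_def)
qed

lemma solves_on_has_integral_sub:
  fixes f :: "real \<Rightarrow> 'a::banach"
  assumes "solves_on a b f F" "a \<le> c" "c \<le> d" "d \<le> b"
  shows "(F has_integral f d - f c) {c..d}"
  using solves_on_has_integral solves_on_subinterval assms by blast

lemma solves_on_continuous:
  fixes f :: "real \<Rightarrow> 'a::banach"
  assumes "solves_on a b f F"
  shows "continuous_on {a..b} f"
proof (cases "a \<le> b")
  case True
  have "continuous_on {a..b} (\<lambda>t. f a + integral {a..t} F)"
    using solves_on_has_integral[OF assms True]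
    by (intro continuous_intros indefinite_integral_continuous_1) (auto simp: has_integral_integrable)
  moreover have "f a + integral {a..t} F = f t" if "t \<in> {a..b}" for t
    using solves_on_has_integral_sub[OF assms order_refl, of t] that by (auto simp: integral_unique)
  ultimately show ?thesis by (rule continuous_on_eq)
qed simp

text \<open>Changing the integrand on a null set does not change the integral, so f is an indefinite
  integral of the continuous G. This turns almost-everywhere equations into classical ones, to which
  Rolle's theorem applies.\<close>

lemma solves_on_has_vector_derivative:
  fixes f :: "real \<Rightarrow> 'a::banach"
  assumes f: "solves_on a b f F" and G: "continuous_on {a..b} G"
    and FG: "AE t in lebesgue_on {a..b}. F t = G t" and t: "t \<in> {a..b}"
  shows "(f has_vector_derivative G t) (at t within {a..b})"
proof -
  have eq: "f s = f a + integral {a..s} G" if "s \<in> {a..b}" for s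
  proof -
    have "(F has_integral f s - f a) {a..s}"
      using solves_on_has_integral_sub[OF f order_refl, of s] that by auto
    then have "(G has_integral f s - f a) {a..s}"
      by (rule has_integral_spike[OF FG[unfolded AE_lebesgue_on_iff_negligible], rotated])
        (use that in auto)
    then show ?thesis by (simp add: integral_unique)
  qed
  have "((\<lambda>s. f a + integral {a..s} G) has_vector_derivative G t) (at t within {a..b})"
    using integral_has_vector_derivative[OF G t] by (auto intro!: derivative_eq_intros)
  then show ?thesis
    by (rule has_vector_derivative_transform[OF t, rotated]) (rule eq)
qed

section \<open>Products and local expansions of solutions\<close>

lemma abs_cont_on_mult:
  fixes f g :: "real \<Rightarrow> real"
  assumes f: "abs_cont_on a b f" and g: "abs_cont_on a b g"
    and M: "\<And>t. t \<in> {a..b} \<Longrightarrow> \<bar>f t\<bar> \<le> M" "\<And>t. t \<in> {a..b} \<Longrightarrow> \<bar>g t\<bar> \<le> M" and "M > 0"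
  shows "abs_cont_on a b (\<lambda>t. f t * g t)"
  unfolding abs_cont_on_def
proof (intro allI impI)
  fix \<epsilon> :: real assume "\<epsilon> > 0"
  define e where "e = \<epsilon> / (2 * M)"
  have "e > 0" using \<open>\<epsilon> > 0\<close> \<open>M > 0\<close> by (simp add: e_def)
  obtain \<delta>1 where \<delta>1: "\<delta>1 > 0" "\<And>D. D division_of \<Union>D \<and> \<Union>D \<subseteq> {a..b} \<and> (\<Sum>K\<in>D. measure lborel K) < \<delta>1
        \<Longrightarrow> (\<Sum>K\<in>D. norm (f (Sup K) - f (Inf K))) < e"
    using f \<open>e > 0\<close> unfolding abs_cont_on_def by metis
  obtain \<delta>2 where \<delta>2: "\<delta>2 > 0" "\<And>D. D division_of \<Union>D \<and> \<Union>D \<subseteq> {a..b} \<and> (\<Sum>K\<in>D. measure lborel K) < \<delta>2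
        \<Longrightarrow> (\<Sum>K\<in>D. norm (g (Sup K) - g (Inf K))) < e"
    using g \<open>e > 0\<close> unfolding abs_cont_on_def by metis
  have "(\<Sum>K\<in>D. norm (f (Sup K) * g (Sup K) - f (Inf K) * g (Inf K))) < \<epsilon>"
    if D: "D division_of \<Union>D" "\<Union>D \<subseteq> {a..b}" "(\<Sum>K\<in>D. measure lborel K) < min \<delta>1 \<delta>2" for D
  proof -
    have "(\<Sum>K\<in>D. norm (f (Sup K) * g (Sup K) - f (Inf K) * g (Inf K)))
       \<le> (\<Sum>K\<in>D. M * norm (f (Sup K) - f (Inf K)) + M * norm (g (Sup K) - g (Inf K)))"
    proof (rule sum_mono)
      fix K assume "K \<in> D"
      then obtain c d where "K = cbox c d" "K \<noteq> {}"
        using D(1) by blast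
      then have K: "K = {c..d}" "c \<le> d" by auto
      have "{c..d} \<subseteq> {a..b}"
        using D(2) \<open>K \<in> D\<close> K(1) by blast
      with K(2) have "c \<in> {a..b}" "d \<in> {a..b}" by auto
      have "f d * g d - f c * g c = (f d - f c) * g d + f c * (g d - g c)"
        by (simp add: algebra_simps)
      then have "\<bar>f d * g d - f c * g c\<bar> \<le> \<bar>f d - f c\<bar> * \<bar>g d\<bar> + \<bar>f c\<bar> * \<bar>g d - g c\<bar>"
        by (simp flip: abs_mult)
      also have "\<dots> \<le> \<bar>f d - f c\<bar> * M + M * \<bar>g d - g c\<bar>"
        using M \<open>c \<in> {a..b}\<close> \<open>d \<in> {a..b}\<close> \<open>M > 0\<close> by (intro add_mono mult_mono) auto
      finally show "norm (f (Sup K) * g (Sup K) - f (Inf K) * g (Inf K))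
          \<le> M * norm (f (Sup K) - f (Inf K)) + M * norm (g (Sup K) - g (Inf K))"
        using K by (simp add: mult.commute)
    qed
    also have "\<dots> = M * ((\<Sum>K\<in>D. norm (f (Sup K) - f (Inf K))) + (\<Sum>K\<in>D. norm (g (Sup K) - g (Inf K))))"
      by (simp add: sum.distrib sum_distrib_left distrib_left)
    also have "\<dots> < M * (e + e)"
      using D \<delta>1(2)[of D] \<delta>2(2)[of D] \<open>M > 0\<close> by (intro mult_strict_left_mono add_strict_mono) auto
    also have "\<dots> = \<epsilon>" using \<open>M > 0\<close> by (simp add: e_def)
    finally show ?thesis .
  qed
  then show "\<exists>\<delta>>0. \<forall>D. D division_of \<Union>D \<and> \<Union>D \<subseteq> {a..b} \<and> (\<Sum>K\<in>D. measure lborel K) < \<delta>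
        \<longrightarrow> (\<Sum>K\<in>D. norm (f (Sup K) * g (Sup K) - f (Inf K) * g (Inf K))) < \<epsilon>"
    using \<delta>1(1) \<delta>2(1) by (intro exI[of _ "min \<delta>1 \<delta>2"]) auto
qed

lemma solves_on_mult:
  fixes f g :: "real \<Rightarrow> real"
  assumes f: "solves_on a b f F" and g: "solves_on a b g G"
  shows "solves_on a b (\<lambda>t. f t * g t) (\<lambda>t. F t * g t + f t * G t)"
proof -
  have "bounded (f ` {a..b})" "bounded (g ` {a..b})"
    by (intro compact_imp_bounded compact_continuous_image solves_on_continuous[OF f]
        solves_on_continuous[OF g] compact_Icc)+
  then obtain M1 M2 where M: "\<forall>t\<in>{a..b}. \<bar>f t\<bar> \<le> M1" "\<forall>t\<in>{a..b}. \<bar>g t\<bar> \<le> M2" "M1 > 0" "M2 > 0"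
    unfolding bounded_pos by auto
  have "abs_cont_on a b (\<lambda>t. f t * g t)"
    by (rule abs_cont_on_mult[where M = "max M1 M2"])
      (use f g M in \<open>auto simp: solves_on_def le_max_iff_disj\<close>)
  moreover have "AE t in lebesgue_on {a..b}.
      ((\<lambda>t. f t * g t) has_vector_derivative F t * g t + f t * G t) (at t within {a..b})"
    using f[unfolded solves_on_def, THEN conjunct2] g[unfolded solves_on_def, THEN conjunct2]
    by eventually_elim
      (auto intro: DERIV_cong[OF DERIV_mult]
        simp: has_real_derivative_iff_has_vector_derivative[symmetric])
  ultimately show ?thesis by (simp add: solves_on_def)
qed

text \<open>The leading term of the derivative is integrated, which raises the order by one.
  Almost-everywhere control of F suffices, because only its integral enters.\<close>

lemma solves_on_expansion:
  fixes f :: "real \<Rightarrow> 'a::banach"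
  assumes f: "solves_on a b f F" and t0: "t0 \<in> {a..b}"
    and F: "\<And>\<epsilon>. \<epsilon> > 0 \<Longrightarrow> \<exists>\<delta>>0. AE t in lebesgue_on {a..b}. \<bar>t - t0\<bar> < \<delta>
        \<longrightarrow> norm (F t - (t - t0) ^ k *\<^sub>R V) \<le> \<epsilon> * \<bar>t - t0\<bar> ^ k"
    and "\<epsilon> > 0"
  shows "\<exists>\<delta>>0. \<forall>t\<in>{a..b}. \<bar>t - t0\<bar> < \<delta> \<longrightarrow>
    norm (f t - f t0 - ((t - t0) ^ Suc k / Suc k) *\<^sub>R V) \<le> \<epsilon> * \<bar>t - t0\<bar> ^ Suc k"
proof -
  obtain \<delta> where \<delta>: "\<delta> > 0" "AE t in lebesgue_on {a..b}. \<bar>t - t0\<bar> < \<delta>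
        \<longrightarrow> norm (F t - (t - t0) ^ k *\<^sub>R V) \<le> \<epsilon> * \<bar>t - t0\<bar> ^ k"
    using F[OF \<open>\<epsilon> > 0\<close>] by blast
  define N where "N = {t\<in>{a..b}. \<not> (\<bar>t - t0\<bar> < \<delta>
        \<longrightarrow> norm (F t - (t - t0) ^ k *\<^sub>R V) \<le> \<epsilon> * \<bar>t - t0\<bar> ^ k)}"
  have N: "negligible N"
    using \<delta>(2) by (simp only: AE_lebesgue_on_iff_negligible N_def)
  define E where "E = (\<lambda>t. f t - f t0 - ((t - t0) ^ Suc k / Suc k) *\<^sub>R V)"
  have "norm (E t) \<le> \<epsilon> * \<bar>t - t0\<bar> ^ Suc k" if t: "t \<in> {a..b}" "\<bar>t - t0\<bar> < \<delta>" for t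
  proof -
    \<comment> \<open>Ordering the two times treats both sides of t0 at once.\<close>
    define c d where "c = min t t0" and "d = max t t0"
    have cd: "a \<le> c" "c \<le> d" "d \<le> b" using t t0 by (auto simp: c_def d_def)
    have D: "((\<lambda>s. (s - t0) ^ Suc k / Suc k) has_real_derivative (s - t0) ^ k) (at s within {c..d})" for s
      by (rule derivative_eq_intros refl | simp del: power_Suc of_nat_Suc)+
    have *: "((\<lambda>s. (s - t0) ^ k *\<^sub>R V) has_integral
        ((d - t0) ^ Suc k / Suc k) *\<^sub>R V - ((c - t0) ^ Suc k / Suc k) *\<^sub>R V) {c..d}"
      by (rule fundamental_theorem_of_calculus[OF \<open>c \<le> d\<close>])
        (use has_vector_derivative_scaleR[OF D has_vector_derivative_const] in simp)
    have "((\<lambda>s. F s - (s - t0) ^ k *\<^sub>R V) has_integral E d - E c) {c..d}"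
      using has_integral_diff[OF solves_on_has_integral_sub[OF f cd] *]
      by (simp add: E_def algebra_simps)
    then have "((\<lambda>s. if s \<in> N then 0 else F s - (s - t0) ^ k *\<^sub>R V) has_integral E d - E c) {c..d}"
      by (rule has_integral_spike[OF N, rotated]) auto
    then have "norm (E d - E c) \<le> (\<epsilon> * \<bar>t - t0\<bar> ^ k) * measure lborel {c..d}"
    proof (rule has_integral_bound[rotated, where a = c and b = d, unfolded box_real])
      show "norm (if s \<in> N then 0 else F s - (s - t0) ^ k *\<^sub>R V) \<le> \<epsilon> * \<bar>t - t0\<bar> ^ k"
        if "s \<in> {c..d}" for s
      proof (cases "s \<in> N")
        case False
        have "\<bar>s - t0\<bar> \<le> \<bar>t - t0\<bar>" using that by (auto simp: c_def d_def)
        then have "norm (F s - (s - t0) ^ k *\<^sub>R V) \<le> \<epsilon> * \<bar>s - t0\<bar> ^ k"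
          using False that cd t unfolding N_def by auto
        also have "\<dots> \<le> \<epsilon> * \<bar>t - t0\<bar> ^ k"
          using \<open>\<bar>s - t0\<bar> \<le> \<bar>t - t0\<bar>\<close> \<open>\<epsilon> > 0\<close> by (intro mult_left_mono power_mono) auto
        finally show ?thesis using False by simp
      qed (use \<open>\<epsilon> > 0\<close> in auto)
    qed (use \<open>\<epsilon> > 0\<close> in auto)
    \<comment> \<open>One of c and d is t0, where E vanishes.\<close>
    moreover have "norm (E d - E c) = norm (E t)"
    proof -
      have "E t0 = 0" by (simp add: E_def)
      then show ?thesis by (auto simp: c_def d_def min_def max_def)
    qed
    moreover have "measure lborel {c..d} = \<bar>t - t0\<bar>"
      using cd by (auto simp: c_def d_def)
    ultimately show ?thesis by (simp add: mult_ac)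
  qed
  then show ?thesis using \<delta>(1) unfolding E_def by blast
qed

section \<open>Piecewise constant controls\<close>

lemma piecewise_const_on_append:
  assumes "piecewise_const_on a c w1" "piecewise_const_on c b w2"
  shows "piecewise_const_on a b (\<lambda>t. if t \<le> c then w1 t else w2 t)"
proof -
  obtain n \<tau> where \<tau>: "\<tau> 0 = a" "\<tau> n = c" "\<And>i. i < n \<Longrightarrow> \<tau> i < \<tau> (Suc i)"
      "\<And>i. i < n \<Longrightarrow> \<exists>c. \<forall>t\<in>{\<tau> i<..<\<tau> (Suc i)}. w1 t = c"
    using assms(1) unfolding piecewise_const_on_def by metis
  obtain m \<sigma> where \<sigma>: "\<sigma> 0 = c" "\<sigma> m = b" "\<And>i. i < m \<Longrightarrow> \<sigma> i < \<sigma> (Suc i)"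
      "\<And>i. i < m \<Longrightarrow> \<exists>c. \<forall>t\<in>{\<sigma> i<..<\<sigma> (Suc i)}. w2 t = c"
    using assms(2) unfolding piecewise_const_on_def by metis
  have le1: "\<tau> i \<le> c" if "i \<le> n" for i
    using that
  proof (induction rule: inc_induct)
    case (step j)
    then show ?case using \<tau>(3)[of j] by simp
  qed (simp add: \<tau>(2))
  have le2: "c \<le> \<sigma> i" if "i \<le> m" for i
    using that by (induction i) (use \<sigma> in \<open>auto simp: Suc_le_eq less_imp_le intro: order.trans\<close>)
  \<comment> \<open>The time c is both \<tau> n and \<sigma> 0, so the two sequences fit together at
    index n. By \<open>le1\<close> and \<open>le2\<close> every open piece lies on one side of c,
    where the conditional selects a single branch.\<close>
  define \<rho> where "\<rho> = (\<lambda>i. if i \<le> n then \<tau> i else \<sigma> (i - n))"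
  have \<rho>: "\<rho> i < \<rho> (Suc i) \<and> (\<exists>k. \<forall>t\<in>{\<rho> i<..<\<rho> (Suc i)}. (if t \<le> c then w1 t else w2 t) = k)"
    if "i < n + m" for i
  proof (cases "i < n")
    case True
    then have "\<rho> i = \<tau> i" "\<rho> (Suc i) = \<tau> (Suc i)" by (auto simp: \<rho>_def)
    moreover obtain k where "\<forall>t\<in>{\<tau> i<..<\<tau> (Suc i)}. w1 t = k" using \<tau>(4)[OF True] by blast
    ultimately show ?thesis using \<tau>(3)[OF True] le1[of "Suc i"] True by (auto intro!: exI[of _ k])
  next
    case False
    then have eq: "\<rho> i = \<sigma> (i - n)" "\<rho> (Suc i) = \<sigma> (Suc (i - n))"
      using \<tau>(2) \<sigma>(1) by (auto simp: \<rho>_def Suc_diff_le)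
    have "i - n < m" using that False by simp
    moreover from this obtain k where "\<forall>t\<in>{\<sigma> (i - n)<..<\<sigma> (Suc (i - n))}. w2 t = k"
      using \<sigma>(4) by blast
    ultimately show ?thesis using \<sigma>(3)[of "i - n"] le2[of "i - n"] by (auto simp: eq intro!: exI[of _ k])
  qed
  moreover have "\<rho> 0 = a" "\<rho> (n + m) = b"
    using \<tau>(1,2) \<sigma>(1,2) by (auto simp: \<rho>_def)
  ultimately show ?thesis
    unfolding piecewise_const_on_def by blast
qed

text \<open>The conclusion of the theorem with the value set as a parameter: it serves both the
  scalar edge control with values -1/2, 1/2 and the control u with values in the vertices.\<close>

definition ae_piecewise_const :: "'a set \<Rightarrow> (real \<Rightarrow> 'a) \<Rightarrow> real \<Rightarrow> real \<Rightarrow> bool" where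
  "ae_piecewise_const V u a b \<longleftrightarrow>
     (\<exists>w. piecewise_const_on a b w \<and> (\<forall>t\<in>{a..b}. w t \<in> V) \<and> (AE t in lebesgue_on {a..b}. u t = w t))"

lemma ae_piecewise_const_append:
  assumes "ae_piecewise_const V u a c" "ae_piecewise_const V u c b" "a \<le> c" "c \<le> b"
  shows "ae_piecewise_const V u a b"
proof -
  obtain w1 where w1: "piecewise_const_on a c w1" "\<And>t. t \<in> {a..c} \<Longrightarrow> w1 t \<in> V"
      "AE t in lebesgue_on {a..c}. u t = w1 t"
    using assms(1) unfolding ae_piecewise_const_def by blast
  obtain w2 where w2: "piecewise_const_on c b w2" "\<And>t. t \<in> {c..b} \<Longrightarrow> w2 t \<in> V"
      "AE t in lebesgue_on {c..b}. u t = w2 t"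
    using assms(2) unfolding ae_piecewise_const_def by blast
  have "negligible ({t\<in>{a..c}. \<not> u t = w1 t} \<union> {t\<in>{c..b}. \<not> u t = w2 t})"
    using w1(3) w2(3) by (auto simp: AE_lebesgue_on_iff_negligible)
  then have "AE t in lebesgue_on {a..b}. u t = (if t \<le> c then w1 t else w2 t)"
    unfolding AE_lebesgue_on_iff_negligible by (rule negligible_subset) auto
  then show ?thesis
    unfolding ae_piecewise_const_def
    using piecewise_const_on_append[OF w1(1) w2(1)] w1(2) w2(2)
    by (intro exI[of _ "\<lambda>t. if t \<le> c then w1 t else w2 t"]) auto
qed

lemma ae_piecewise_const_const:
  assumes "AE t in lebesgue_on {a..b}. u t = v" "v \<in> V" "a \<le> b"
  shows "ae_piecewise_const V u a b"
proof -
  have "piecewise_const_on a b (\<lambda>_. v)"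
    unfolding piecewise_const_on_def
    \<comment> \<open>Breakpoints increase strictly, so a degenerate interval has zero
      pieces.\<close>
    by (intro exI[of _ "if a < b then 1 else 0 :: nat"] exI[of _ "\<lambda>i. if i = 0 then a else b"])
      (use assms in auto)
  then show ?thesis
    using assms unfolding ae_piecewise_const_def by blast
qed

lemma ae_piecewise_const_singleton:
  assumes "V \<noteq> {}"
  shows "ae_piecewise_const V u a a"
  using assms ae_piecewise_const_const[where u = u and a = a and b = a]
  by (fastforce simp: AE_lebesgue_on_iff_negligible intro: negligible_subset[of "{a}"])

text \<open>Compactness of [a,b] in the form of Bolzano's bisection principle: the property is
  additive over adjacent intervals, and near each t the two one-sided hypotheses are glued at t.
  Left and right are kept apart because the order of the switching functions may reverse at
  t.\<close>

lemma ae_piecewise_const_local: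
  assumes "a \<le> b" "V \<noteq> {}"
    and right: "\<And>t. \<lbrakk>a \<le> t; t < b\<rbrakk> \<Longrightarrow>
      \<exists>\<delta>>0. \<forall>d. t < d \<and> d \<le> b \<and> d < t + \<delta> \<longrightarrow> ae_piecewise_const V u t d"
    and left: "\<And>t. \<lbrakk>a < t; t \<le> b\<rbrakk> \<Longrightarrow>
      \<exists>\<delta>>0. \<forall>c. c < t \<and> a \<le> c \<and> t - \<delta> < c \<longrightarrow> ae_piecewise_const V u c t"
  shows "ae_piecewise_const V u a b"
proof -
  have "a \<le> a \<and> b \<le> b \<longrightarrow> ae_piecewise_const V u a b"
    using \<open>a \<le> b\<close>
  proof (induction rule: Bolzano[where P = "\<lambda>c d. a \<le> c \<and> d \<le> b \<longrightarrow> ae_piecewise_const V u c d"])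
    case (trans c e d)
    then show ?case by (auto intro: ae_piecewise_const_append)
  next
    case (local t)
    \<comment> \<open>At t = b no admissible d exists, so any radius will do; likewise on the left
      at t = a.\<close>
    obtain r where r: "r > 0" "\<And>d. t < d \<Longrightarrow> d \<le> b \<Longrightarrow> d < t + r \<Longrightarrow> ae_piecewise_const V u t d"
      using right[of t] local by (cases "t < b") (auto intro: that[of 1])
    obtain l where l: "l > 0" "\<And>c. c < t \<Longrightarrow> a \<le> c \<Longrightarrow> t - l < c \<Longrightarrow> ae_piecewise_const V u c t"
      using left[of t] local by (cases "a < t") (auto intro: that[of 1])
    have "ae_piecewise_const V u c d" if "c \<le> t" "t \<le> d" "d - c < min l r" "a \<le> c" "d \<le> b" for c d
    proof (rule ae_piecewise_const_append)
      show "ae_piecewise_const V u c t"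
        using l(2)[of c] ae_piecewise_const_singleton[OF \<open>V \<noteq> {}\<close>] that by (cases "c = t") auto
      show "ae_piecewise_const V u t d"
        using r(2)[of d] ae_piecewise_const_singleton[OF \<open>V \<noteq> {}\<close>] that by (cases "d = t") auto
    qed (use that in auto)
    then show ?case using l(1) r(1) by (intro exI[of _ "min l r"]) auto
  qed
  then show ?thesis by simp
qed

lemma AE_lebesgue_on_obtain:
  assumes "AE t in lebesgue_on {a..b::real}. P t" "a < b"
  obtains t where "t \<in> {a..b}" "P t"
proof -
  have "\<not> negligible {a..b}"
    using assms(2) by (metis negligible_interval(1) box_real(1) box_real(2) greaterThanLessThan_empty_iff not_le)
  then have "{t\<in>{a..b}. \<not> P t} \<noteq> {a..b}"
    using assms(1) unfolding AE_lebesgue_on_iff_negligible by metis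
  then show thesis using that by blast
qed

lemma AE_lebesgue_on_interior:
  assumes "AE t in lebesgue_on {a..b::real}. t \<in> {a<..<b} \<longrightarrow> P t"
  shows "AE t in lebesgue_on {a..b}. P t"
proof -
  have "negligible ({t\<in>{a..b}. \<not> (t \<in> {a<..<b} \<longrightarrow> P t)} \<union> {a, b})"
    using assms unfolding AE_lebesgue_on_iff_negligible by (intro negligible_Un) auto
  then show ?thesis
    unfolding AE_lebesgue_on_iff_negligible by (rule negligible_subset) auto
qed

lemma ae_piecewise_const_map:
  assumes "ae_piecewise_const V v a b" "AE t in lebesgue_on {a..b}. u t = h (v t)" "h ` V \<subseteq> W"
  shows "ae_piecewise_const W u a b"
proof -
  obtain w where w: "piecewise_const_on a b w" "\<And>t. t \<in> {a..b} \<Longrightarrow> w t \<in> V"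
      "AE t in lebesgue_on {a..b}. v t = w t"
    using assms(1) unfolding ae_piecewise_const_def by blast
  have "piecewise_const_on a b (\<lambda>t. h (w t))"
    using w(1) unfolding piecewise_const_on_def by metis
  moreover have "AE t in lebesgue_on {a..b}. u t = h (w t)"
    using w(3) assms(2) by eventually_elim simp
  ultimately show ?thesis
    using w(2) assms(3) unfolding ae_piecewise_const_def by (intro exI[of _ "\<lambda>t. h (w t)"]) auto
qed

section \<open>The edge problem\<close>

lemma Rolle_within:
  fixes f :: "real \<Rightarrow> real"
  assumes f: "\<And>t. t \<in> {a..b} \<Longrightarrow> (f has_vector_derivative f' t) (at t within {a..b})"
    and pq: "a \<le> p" "p < q" "q \<le> b" "f p = f q"
  shows "\<exists>t. p < t \<and> t < q \<and> f' t = 0"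
proof -
  have cont: "continuous_on {p..q} f"
    by (rule continuous_on_subset[of "{a..b}"])
      (use continuous_on_vector_derivative[OF f] pq in auto)
  have D: "(f has_real_derivative f' t) (at t)" if "p < t" "t < q" for t
    using f[of t] that pq
    by (simp add: at_within_Icc_at has_real_derivative_iff_has_vector_derivative)
  then have "\<And>t. p < t \<Longrightarrow> t < q \<Longrightarrow> f differentiable (at t)"
    using real_differentiable_def by blast
  then obtain t where "p < t" "t < q" "(f has_real_derivative 0) (at t)"
    using Rolle[OF pq(2) pq(4) cont] by blast
  then show ?thesis using D DERIV_unique by blast
qed

text \<open>Both 2 |v| \<le> 1 and sqrt 3 |x| < 1, so the product of the two is below 1 and
  \<open>edge_f2\<close> has no pole in v.\<close>

lemma edge_f2_denominator_neg:
  assumes "\<bar>x\<bar> < 1 / sqrt 3" "v \<in> {-1/2..1/2}"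
  shows "- 1 + 2 * sqrt 3 * x * v < 0"
proof -
  have "\<bar>2 * v\<bar> * (\<bar>x\<bar> * sqrt 3) \<le> 1 * (\<bar>x\<bar> * sqrt 3)"
    using assms by (intro mult_right_mono) auto
  also have "\<dots> < 1" using assms(1) by (simp add: field_simps)
  finally have "\<bar>2 * sqrt 3 * x * v\<bar> < 1" by (simp add: abs_mult mult_ac)
  then show ?thesis by linarith
qed

text \<open>As a function of v, \<open>edge_f2\<close> is a Moebius transformation without pole on
  the control interval; cross-multiplication reduces the comparison to the sign of v - w.\<close>

lemma edge_f2_strict_antimono:
  assumes "y > 0" "\<bar>x\<bar> < 1 / sqrt 3" "v \<in> {-1/2..1/2}" "w \<in> {-1/2..1/2}" "v < w"
  shows "edge_f2 x y w < edge_f2 x y v"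
proof -
  define p q where "p = - 1 + 2 * sqrt 3 * x * v" and "q = - 1 + 2 * sqrt 3 * x * w"
  have neg: "p < 0" "q < 0"
    using edge_f2_denominator_neg assms by (auto simp: p_def q_def)
  have "w / q - v / p = (w * p - v * q) / (p * q)"
    using neg by (simp add: field_simps)
  also have "w * p - v * q = v - w"
    by (simp add: p_def q_def algebra_simps)
  also have "(v - w) / (p * q) < 0"
    using assms(5) neg by (intro divide_neg_pos mult_neg_neg) auto
  finally have "(2 * sqrt 3 * y\<^sup>2) * (w / q) < (2 * sqrt 3 * y\<^sup>2) * (v / p)"
    using assms(1) by (intro mult_strict_left_mono) auto
  then show ?thesis by (simp add: edge_f2_def p_def q_def)
qed

text \<open>The control enters the Hamiltonian only through l2 times the strictly decreasing
  \<open>edge_f2\<close>, so the sign of l2 selects the endpoint.\<close>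

lemma edge_maximizer:
  assumes "y > 0" "\<bar>x\<bar> < 1 / sqrt 3" "v \<in> {-1/2..1/2}"
    and max: "\<forall>w\<in>{-1/2..1/2}. edge_Ham l1 l2 l3 lc s x y w \<le> edge_Ham l1 l2 l3 lc s x y v"
    and "l2 \<noteq> 0"
  shows "v = (if l2 > 0 then - 1/2 else 1/2)"
proof (rule ccontr)
  assume neq: "v \<noteq> (if l2 > 0 then - 1/2 else 1/2)"
  show False
  proof (cases "l2 > 0")
    case True
    then have "edge_f2 x y v < edge_f2 x y (-1/2)"
      using neq assms by (intro edge_f2_strict_antimono) auto
    moreover have "l2 * edge_f2 x y (-1/2) \<le> l2 * edge_f2 x y v"
      using max[rule_format, of "-1/2"] by (simp add: edge_Ham_def)
    ultimately show False using True by simp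
  next
    case False
    then have "edge_f2 x y (1/2) < edge_f2 x y v"
      using neq assms by (intro edge_f2_strict_antimono) auto
    moreover have "l2 * edge_f2 x y (1/2) \<le> l2 * edge_f2 x y v"
      using max[rule_format, of "1/2"] by (simp add: edge_Ham_def)
    ultimately show False using False \<open>l2 \<noteq> 0\<close> by (simp add: mult_le_cancel_left)
  qed
qed

lemma deriv_edge_Ham_y:
  assumes "y > 0"
  shows "deriv (\<lambda>\<eta>. edge_Ham l1 l2 l3 lc s x \<eta> v) y
    = l1 + 2 * l2 * edge_f2 x y v / y - (l3 + lc * x\<^sup>2) / y\<^sup>2"
proof -
  \<comment> \<open>\<open>edge_f2\<close> is quadratic in y, so its derivative in y is twice its
    value divided by y.\<close>
  define c where "c = 2 * sqrt 3 * v / (- 1 + 2 * sqrt 3 * x * v)"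
  have f2: "edge_f2 x \<eta> v = c * \<eta>\<^sup>2" for \<eta> by (simp add: edge_f2_def c_def)
  have "((\<lambda>\<eta>. edge_Ham l1 l2 l3 lc s x \<eta> v) has_real_derivative
     l1 + 2 * l2 * edge_f2 x y v / y - (l3 + lc * x\<^sup>2) / y\<^sup>2) (at y)"
    unfolding edge_Ham_def f2 using assms
    by (auto intro!: derivative_eq_intros simp: field_simps power2_eq_square)
  then show ?thesis by (rule DERIV_imp_deriv)
qed

lemma finite_square_eq:
  fixes c :: real
  shows "finite {z. z\<^sup>2 = c}"
proof (rule finite_subset)
  show "{z. z\<^sup>2 = c} \<subseteq> {sqrt c, - sqrt c}" by (auto simp: abs_if)
qed auto

text \<open>The control can switch only where l2 vanishes. Those times are isolated, and between
  them the control sits at one endpoint.\<close>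

lemma edge_problem_bang_bang:
  assumes "edge_problem_extremal a b s x y v" "a < b"
  shows "ae_piecewise_const {-1/2, 1/2} v a b"
proof -
  have v: "\<And>t. t \<in> {a..b} \<Longrightarrow> v t \<in> {-1/2..1/2}"
    and y: "\<And>t. t \<in> {a..b} \<Longrightarrow> y t > 0"
    and x: "\<And>t. t \<in> {a..b} \<Longrightarrow> \<bar>x t\<bar> < 1 / sqrt 3"
    and sx: "solves_on a b x y"
    and sy: "solves_on a b y (\<lambda>t. edge_f2 (x t) (y t) (v t))"
    using assms(1) unfolding edge_problem_extremal_def by blast+
  obtain lc l1 l2 l3 where
    nz: "\<And>t. t \<in> {a..b} \<Longrightarrow> (l1 t, l2 t, l3 t, lc) \<noteq> 0"
    and s2: "solves_on a b l2
          (\<lambda>t. - deriv (\<lambda>\<eta>. edge_Ham (l1 t) (l2 t) (l3 t) lc (s t) (x t) \<eta> (v t)) (y t))"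
    and s3: "solves_on a b l3
          (\<lambda>t. - deriv (\<lambda>\<sigma>. edge_Ham (l1 t) (l2 t) (l3 t) lc \<sigma> (x t) (y t) (v t)) (s t))"
    and max: "AE t in lebesgue_on {a..b}.
           (\<forall>w\<in>{-1/2..1/2}. edge_Ham (l1 t) (l2 t) (l3 t) lc (s t) (x t) (y t) w
              \<le> edge_Ham (l1 t) (l2 t) (l3 t) lc (s t) (x t) (y t) (v t)) \<and>
           edge_Ham (l1 t) (l2 t) (l3 t) lc (s t) (x t) (y t) (v t) = 0"
    using assms(1) unfolding edge_problem_extremal_def by blast
  have mem: "AE t in lebesgue_on {a..b}. t \<in> {a..b}"
    by (auto intro!: AE_I2)
  define k where "k = l3 a"
  have l3: "l3 t = k" if "t \<in> {a..b}" for t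
  proof -
    have "((\<lambda>t. - deriv (\<lambda>\<sigma>. edge_Ham (l1 t) (l2 t) (l3 t) lc \<sigma> (x t) (y t) (v t)) (s t))
       has_integral l3 t - l3 a) {a..t}"
      by (rule solves_on_has_integral_sub[OF s3]) (use that in auto)
    then show ?thesis by (simp add: edge_Ham_def k_def has_integral_0_eq)
  qed
  have cont: "continuous_on {a..b} x" "continuous_on {a..b} y"
    using sx sy by (auto intro: solves_on_continuous)
  \<comment> \<open>The factor y > 0 preserves the zeros and signs of l2. It makes the terms with
    \<open>edge_f2\<close> cancel once H = 0 is used, so the derivative G contains no control and is
    continuous.\<close>
  define \<phi> where "\<phi> = (\<lambda>t. l2 t * y t)"
  define G where "G = (\<lambda>t. 2 * (k + lc * (x t)\<^sup>2) / y t)"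
  have s\<phi>: "solves_on a b \<phi> (\<lambda>t. - deriv (\<lambda>\<eta>. edge_Ham (l1 t) (l2 t) (l3 t) lc (s t) (x t) \<eta> (v t)) (y t) * y t
      + l2 t * edge_f2 (x t) (y t) (v t))"
    unfolding \<phi>_def by (rule solves_on_mult[OF s2 sy])
  have "AE t in lebesgue_on {a..b}.
     - deriv (\<lambda>\<eta>. edge_Ham (l1 t) (l2 t) (l3 t) lc (s t) (x t) \<eta> (v t)) (y t) * y t
      + l2 t * edge_f2 (x t) (y t) (v t) = G t"
    using max mem
  proof eventually_elim
    case (elim t)
    then have "y t > 0" "l3 t = k" using y l3 by auto
    \<comment> \<open>The vanishing of the Hamiltonian, solved for the term with l1.\<close>
    moreover have "l1 t * y t = - (l2 t * edge_f2 (x t) (y t) (v t)) - (k + lc * (x t)\<^sup>2) / y t"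
      using elim \<open>l3 t = k\<close> by (simp add: edge_Ham_def add_divide_distrib)
    moreover have "(l1 t + 2 * l2 t * edge_f2 (x t) (y t) (v t) / y t - (k + lc * (x t)\<^sup>2) / (y t)\<^sup>2) * y t
        = l1 t * y t + 2 * l2 t * edge_f2 (x t) (y t) (v t) - (k + lc * (x t)\<^sup>2) / y t"
      using \<open>y t > 0\<close> by (simp add: field_simps power2_eq_square)
    ultimately have "- ((l1 t + 2 * l2 t * edge_f2 (x t) (y t) (v t) / y t - (k + lc * (x t)\<^sup>2) / (y t)\<^sup>2) * y t)
        + l2 t * edge_f2 (x t) (y t) (v t) = 2 * ((k + lc * (x t)\<^sup>2) / y t)"
      by linarith
    then show ?case
      by (simp only: deriv_edge_Ham_y[OF \<open>y t > 0\<close>] mult_minus_left G_def times_divide_eq_right \<open>l3 t = k\<close>)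
  qed
  moreover have "continuous_on {a..b} G"
    unfolding G_def using y by (intro continuous_intros cont) force
  ultimately have D\<phi>: "(\<phi> has_vector_derivative G t) (at t within {a..b})" if "t \<in> {a..b}" for t
    using solves_on_has_vector_derivative[OF s\<phi>] that by blast
  have Dx: "(x has_vector_derivative y t) (at t within {a..b})" if "t \<in> {a..b}" for t
    using solves_on_has_vector_derivative[OF sx cont(2) _ that] by simp
  have "inj_on x {a..b}"
  proof (rule linorder_inj_onI')
    fix p q assume "p \<in> {a..b}" "q \<in> {a..b}" "p < q"
    then show "x p \<noteq> x q"
      using Rolle_within[OF Dx, of p q] y by (metis atLeastAtMost_iff less_imp_le less_irrefl order_trans)
  qed
  have isol: "\<exists>\<delta>>0. \<forall>t\<in>{a..b}. t \<noteq> t0 \<and> \<bar>t - t0\<bar> < \<delta> \<longrightarrow> \<phi> t \<noteq> 0" if t0: "t0 \<in> {a..b}" for t0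
  proof (cases "\<phi> t0 = 0")
    case False
    have "continuous (at t0 within {a..b}) \<phi>"
      using D\<phi>[OF t0] has_vector_derivative_continuous by blast
    then show ?thesis
      using continuous_within_avoid[of t0 "{a..b}" \<phi> 0] False by (auto simp: dist_real_def abs_minus_commute)
  next
    case True
    \<comment> \<open>Otherwise \<phi> is constant, hence zero, so l2 vanishes; then H = 0 forces l1
      = 0 as well, against nontriviality. As H = 0 holds only almost everywhere, one suitable time t
      is picked.\<close>
    have "k \<noteq> 0 \<or> lc \<noteq> 0"
    proof (rule ccontr)
      assume 0: "\<not> (k \<noteq> 0 \<or> lc \<noteq> 0)"
      obtain t where t: "t \<in> {a..b}" "edge_Ham (l1 t) (l2 t) (l3 t) lc (s t) (x t) (y t) (v t) = 0"
        using AE_lebesgue_on_obtain[OF max \<open>a < b\<close>] by blast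
      have "(\<phi> has_vector_derivative 0) (at r within {a..b})" if "r \<in> {a..b}" for r
        using D\<phi>[OF that] 0 by (simp add: G_def)
      then have "\<phi> t = \<phi> t0"
        using has_vector_derivative_zero_constant[of "{a..b}" \<phi>] t(1) t0 by (metis convex_real_interval(5))
      then have "\<phi> t = 0" using True by simp
      then have "l2 t = 0" using y[OF t(1)] by (simp add: \<phi>_def)
      moreover from this have "l1 t = 0"
        using t 0 l3[OF t(1)] y[OF t(1)] by (simp add: edge_Ham_def)
      ultimately show False using nz[OF t(1)] l3[OF t(1)] 0 by (simp add: zero_prod_def)
    qed
    \<comment> \<open>The zeros of G. They are finitely many, because the condition is nontrivial in
      the square of x and x is injective.\<close>
    define B where "B = {t\<in>{a..b}. k + lc * (x t)\<^sup>2 = 0}"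
    have "finite B"
    proof (cases "lc = 0")
      case True
      then show ?thesis using \<open>k \<noteq> 0 \<or> lc \<noteq> 0\<close> by (simp add: B_def)
    next
      case False
      then have "B \<subseteq> x -` {z. z\<^sup>2 = - k / lc} \<inter> {a..b}"
        by (auto simp: B_def field_simps)
      then show ?thesis
        using finite_vimage_IntI[OF finite_square_eq \<open>inj_on x {a..b}\<close>] finite_subset by blast
    qed
    then obtain \<delta> where \<delta>: "\<delta> > 0" "\<And>t. t \<in> B \<Longrightarrow> t \<noteq> t0 \<Longrightarrow> \<delta> \<le> dist t0 t"
      using finite_set_avoid by metis
    \<comment> \<open>By Rolle, a second zero of \<phi> would put a zero of G strictly between it
      and t0, closer to t0 than B allows.\<close>
    have "\<phi> t \<noteq> 0" if t: "t \<in> {a..b}" "t \<noteq> t0" "\<bar>t - t0\<bar> < \<delta>" for t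
    proof
      assume "\<phi> t = 0"
      then have "a \<le> min t t0" "min t t0 < max t t0" "max t t0 \<le> b" "\<phi> (min t t0) = \<phi> (max t t0)"
        using t t0 True by (auto simp: min_def max_def)
      then obtain r where r: "min t t0 < r" "r < max t t0" "G r = 0"
        using Rolle_within[OF D\<phi>] by blast
      then have "r \<in> {a..b}" using t t0 by auto
      then have "r \<in> B" using r(3) y[of r] by (auto simp: B_def G_def)
      then show False using \<delta>(2)[of r] r t by (auto simp: dist_real_def min_def max_def split: if_splits)
    qed
    then show ?thesis using \<delta>(1) by blast
  qed
  have sign: "ae_piecewise_const {-1/2, 1/2} v c d"
    if cd: "a \<le> c" "c < d" "d \<le> b" and nz: "\<And>t. c < t \<Longrightarrow> t < d \<Longrightarrow> \<phi> t \<noteq> 0" for c d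
  proof -
    \<comment> \<open>By the intermediate value property \<phi> keeps one sign on the open interval,
      and so does l2.\<close>
    have "continuous_on {a..b} \<phi>" using solves_on_continuous[OF s\<phi>] .
    then have "connected (\<phi> ` {c<..<d})"
      using cd by (intro connected_continuous_image) (auto intro: continuous_on_subset)
    moreover have "0 \<notin> \<phi> ` {c<..<d}" using nz by auto
    ultimately have "(\<forall>t\<in>{c<..<d}. \<phi> t > 0) \<or> (\<forall>t\<in>{c<..<d}. \<phi> t < 0)"
      using connectedD_interval[of "\<phi> ` {c<..<d}" _ _ 0] by (meson imageI linorder_neqE_linordered_idom nz greaterThanLessThan_iff less_imp_le)
    then obtain v0 where v0: "v0 \<in> {-1/2, 1/2 :: real}"
      "\<And>t. t \<in> {c<..<d} \<Longrightarrow> (if \<phi> t > 0 then - 1/2 else 1/2) = v0"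
    proof (elim disjE)
      assume "\<forall>t\<in>{c<..<d}. \<phi> t > 0"
      then show thesis by (intro that[of "-1/2"]) simp_all
    next
      assume "\<forall>t\<in>{c<..<d}. \<phi> t < 0"
      then have "(if \<phi> t > 0 then - 1/2 else 1/2) = (1/2 :: real)" if "t \<in> {c<..<d}" for t
        using that by (meson less_asym)
      then show thesis by (intro that[of "1/2"]) simp_all
    qed
    have "AE t in lebesgue_on {c..d}. t \<in> {c<..<d} \<longrightarrow> v t = v0"
      using AE_lebesgue_on_subinterval[OF max cd(1,3)]
    proof eventually_elim
      case (elim t)
      show ?case
      proof
        assume t: "t \<in> {c<..<d}"
        then have tab: "t \<in> {a..b}" using cd by auto
        then have "l2 t \<noteq> 0" "l2 t > 0 \<longleftrightarrow> \<phi> t > 0"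
          using nz[of t] t y[OF tab] by (auto simp: \<phi>_def zero_less_mult_iff)
        then show "v t = v0"
          using edge_maximizer[OF y[OF tab] x[OF tab] v[OF tab]] elim v0(2)[OF t] by metis
      qed
    qed
    then have "AE t in lebesgue_on {c..d}. v t = v0"
      by (rule AE_lebesgue_on_interior)
    then show ?thesis
      using ae_piecewise_const_const v0(1) cd(2) by (metis less_imp_le)
  qed
  show ?thesis
  proof (rule ae_piecewise_const_local)
    fix t assume t: "a \<le> t" "t < b"
    then obtain \<delta> where \<delta>: "\<delta> > 0" "\<And>r. r \<in> {a..b} \<Longrightarrow> r \<noteq> t \<Longrightarrow> \<bar>r - t\<bar> < \<delta> \<Longrightarrow> \<phi> r \<noteq> 0"
      using isol[of t] by auto
    show "\<exists>\<delta>>0. \<forall>d. t < d \<and> d \<le> b \<and> d < t + \<delta> \<longrightarrow> ae_piecewise_const {-1/2, 1/2} v t d"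
    proof (intro exI[of _ \<delta>] conjI allI impI)
      fix d assume "t < d \<and> d \<le> b \<and> d < t + \<delta>"
      then show "ae_piecewise_const {-1/2, 1/2} v t d"
        using \<delta>(2) t by (intro sign) auto
    qed fact
  next
    fix t assume t: "a < t" "t \<le> b"
    then obtain \<delta> where \<delta>: "\<delta> > 0" "\<And>r. r \<in> {a..b} \<Longrightarrow> r \<noteq> t \<Longrightarrow> \<bar>r - t\<bar> < \<delta> \<Longrightarrow> \<phi> r \<noteq> 0"
      using isol[of t] by auto
    show "\<exists>\<delta>>0. \<forall>c. c < t \<and> a \<le> c \<and> t - \<delta> < c \<longrightarrow> ae_piecewise_const {-1/2, 1/2} v c t"
    proof (intro exI[of _ \<delta>] conjI allI impI)
      fix c assume "c < t \<and> a \<le> c \<and> t - \<delta> < c"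
      then show "ae_piecewise_const {-1/2, 1/2} v c t"
        using \<delta>(2) t by (intro sign) auto
    qed fact
  qed (use assms(2) in auto)
qed

text \<open>The rotation has order three; this carries results for the edge u0 = 0 back to the other
  edges.\<close>

lemma ctrl_rot_pow_3: "j \<le> 3 \<Longrightarrow> (ctrl_rot ^^ (3 - j)) ((ctrl_rot ^^ j) w) = w"
  by (cases w) (simp add: numeral_3_eq_3 flip: funpow_add o_apply[of "ctrl_rot ^^ _" "ctrl_rot ^^ _"])

lemma ctrl_rot_pow_vertices: "(ctrl_rot ^^ j) ` UT_vertices \<subseteq> UT_vertices"
  by (induction j) (auto simp: UT_vertices_def)

text \<open>After j rotations the edge problem for u0 = 0 applies. Its extreme controls -1/2 and 1/2
  are the two ends of that edge, and rotating back permutes the vertices.\<close>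

lemma edge_extremal_bang_bang:
  assumes "edge_extremal t1 t2 X u" "j < 3" "t1 \<le> a" "a < b" "b \<le> t2"
    and "AE t in lebesgue_on {a..b}. fst ((ctrl_rot ^^ j) (u t)) = 0"
  shows "ae_piecewise_const UT_vertices u a b"
proof -
  have "edge0_extremal a b (\<lambda>t. (conjR ^^ j) (X t)) (\<lambda>t. (ctrl_rot ^^ j) (u t))"
    using assms unfolding edge_extremal_def by blast
  then obtain s x y ue where
    ue: "AE t in lebesgue_on {a..b}. (ctrl_rot ^^ j) (u t) = (0, 1/2 + ue t, 1/2 - ue t)"
    and "edge_problem_extremal a b s x y ue"
    unfolding edge0_extremal_def by blast
  then have "ae_piecewise_const {-1/2, 1/2} ue a b"
    using edge_problem_bang_bang \<open>a < b\<close> by blast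
  then show ?thesis
  proof (rule ae_piecewise_const_map)
    show "AE t in lebesgue_on {a..b}. u t = (ctrl_rot ^^ (3 - j)) (0, 1/2 + ue t, 1/2 - ue t)"
      using ue by eventually_elim (metis assms(2) ctrl_rot_pow_3 less_imp_le)
    have "(\<lambda>v. (ctrl_rot ^^ (3 - j)) (0, 1/2 + v, 1/2 - v)) ` {-1/2, 1/2}
        \<subseteq> (ctrl_rot ^^ (3 - j)) ` UT_vertices"
      by (auto simp: UT_vertices_def)
    then show "(\<lambda>v. (ctrl_rot ^^ (3 - j)) (0, 1/2 + v, 1/2 - v)) ` {-1/2, 1/2} \<subseteq> UT_vertices"
      using ctrl_rot_pow_vertices by blast
  qed
qed

section \<open>Switching functions\<close>

lemma tform_eq: "tform A B = A$1$1 * B$1$1 + A$1$2 * B$2$1 + A$2$1 * B$1$2 + A$2$2 * B$2$2"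
  by (simp add: tform_def trace_def matrix_matrix_mult_def sum_2)

lemma bracket_nth:
  "bracket A B $ 1 $ 1 = A$1$2 * B$2$1 - B$1$2 * A$2$1"
  "bracket A B $ 1 $ 2 = A$1$1 * B$1$2 + A$1$2 * B$2$2 - B$1$1 * A$1$2 - B$1$2 * A$2$2"
  "bracket A B $ 2 $ 1 = A$2$1 * B$1$1 + A$2$2 * B$2$1 - B$2$1 * A$1$1 - B$2$2 * A$2$1"
  "bracket A B $ 2 $ 2 = A$2$1 * B$1$2 - B$2$1 * A$1$2"
  by (simp_all add: bracket_def matrix_matrix_mult_def sum_2)

lemma sl2_iff: "A \<in> sl2 \<longleftrightarrow> A$2$2 = - A$1$1"
  by (auto simp: sl2_def trace_def sum_2)

lemma bracket_in_sl2: "bracket A B \<in> sl2"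
  by (simp add: sl2_iff bracket_nth)

lemma tform_bracket_right: "tform (bracket A B) B = 0"
  by (simp add: tform_eq bracket_nth algebra_simps)

lemma tform_commute: "tform A B = tform B A"
  by (simp add: tform_eq)

lemma bounded_bilinear_tform: "bounded_bilinear tform"
  unfolding bilinear_conv_bounded_bilinear[symmetric] bilinear_def
  by (auto intro!: linearI simp: tform_eq algebra_simps)

lemma bounded_bilinear_bracket: "bounded_bilinear bracket"
  unfolding bilinear_conv_bounded_bilinear[symmetric] bilinear_def
  by (auto intro!: linearI simp: mat2_eq_iff bracket_nth algebra_simps)

lemma Phi_hstar_cases:
  assumes "X \<in> Phi ` hstar"
  obtains x y where "y > 0" "\<bar>x\<bar> < 1 / sqrt 3" "x\<^sup>2 + y\<^sup>2 > 1 / 3"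
    "X = mat22 (x / y) (- (x\<^sup>2 + y\<^sup>2) / y) (1 / y) (- x / y)"
  using assms by (auto simp: Phi_def hstar_def)

lemma Phi_in_sl2: "X \<in> Phi ` hstar \<Longrightarrow> X \<in> sl2"
  by (erule Phi_hstar_cases) (simp add: sl2_iff)

lemma Phi_det: "X \<in> Phi ` hstar \<Longrightarrow> (X$1$1)\<^sup>2 + X$1$2 * X$2$1 = - 1"
  by (erule Phi_hstar_cases) (simp add: field_simps power2_eq_square)

lemma tform_Phi_self: "X \<in> Phi ` hstar \<Longrightarrow> tform X X = - 2"
  using Phi_det[of X] Phi_in_sl2[of X] by (simp add: tform_eq sl2_iff power2_eq_square algebra_simps)

text \<open>The trace-free matrices commuting with X are the multiples of X, and X is not orthogonal
  to itself. The coordinate proof uses only that X is trace-free of determinant 1.\<close>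

lemma bracket_Phi_eq_0:
  assumes "M \<in> sl2" "X \<in> Phi ` hstar" "tform M X = 0" "bracket M X = 0"
  shows "M = 0"
proof -
  define p q r where "p = M$1$1" and "q = M$1$2" and "r = M$2$1"
  define \<alpha> \<beta> \<gamma> where "\<alpha> = X$1$1" and "\<beta> = X$1$2" and "\<gamma> = X$2$1"
  note defs = p_def q_def r_def \<alpha>_def \<beta>_def \<gamma>_def
  have M22: "M$2$2 = - p" and X22: "X$2$2 = - \<alpha>"
    using assms(1) Phi_in_sl2[OF assms(2)] by (simp_all add: sl2_iff defs)
  have "bracket M X $ 1 $ 1 = 0" "bracket M X $ 1 $ 2 = 0" "bracket M X $ 2 $ 1 = 0"
    by (simp_all add: assms(4))
  then have "q * \<gamma> - \<beta> * r = 0" "p * \<beta> + q * - \<alpha> - \<alpha> * q - \<beta> * - p = 0"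
      "r * \<alpha> + - p * \<gamma> - \<gamma> * p - - \<alpha> * r = 0" "p * \<alpha> + q * \<gamma> + r * \<beta> + - p * - \<alpha> = 0"
    using assms(3) by (simp_all only: bracket_nth tform_eq M22 X22 defs)
  then have eqs: "q * \<gamma> = \<beta> * r" "p * \<beta> = q * \<alpha>" "r * \<alpha> = p * \<gamma>" "p * \<alpha> = - (q * \<gamma>)"
    by (simp_all add: algebra_simps)
  have det: "\<alpha> * \<alpha> + \<beta> * \<gamma> = - 1"
    using Phi_det[OF assms(2)] by (simp add: defs power2_eq_square)
  \<comment> \<open>Each coordinate of M is multiplied by \<alpha> * \<alpha> + \<beta> * \<gamma> =
    -1 and shown to give zero.\<close>
  have "p * (\<alpha> * \<alpha> + \<beta> * \<gamma>) = (p * \<alpha>) * \<alpha> + (p * \<beta>) * \<gamma>" by (simp add: algebra_simps)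
  also have "\<dots> = 0" unfolding eqs(4) eqs(2) by (simp add: algebra_simps)
  finally have "p = 0" by (simp add: det)
  then have 0: "q * \<alpha> = 0" "q * \<gamma> = 0" "r * \<beta> = 0" "r * \<alpha> = 0"
    using eqs by (simp_all add: mult.commute)
  have "(q * \<alpha>) * \<alpha> + (q * \<gamma>) * \<beta> = q * (\<alpha> * \<alpha> + \<beta> * \<gamma>)"
    "(r * \<alpha>) * \<alpha> + (r * \<beta>) * \<gamma> = r * (\<alpha> * \<alpha> + \<beta> * \<gamma>)"
    by (simp_all add: algebra_simps)
  then have "q = 0" "r = 0" unfolding 0 det by simp_all
  then show ?thesis
    using \<open>p = 0\<close> assms(1) by (simp add: mat2_eq_iff sl2_iff defs)
qed

text \<open>Commuting with J forces x = 0 and y = 1 or -1, and y > 0 leaves J = \<open>Phi\<close>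
  \<i>. This is how avoiding the singular locus yields a nonzero bracket of L1 and X in the most
  degenerate case.\<close>

lemma bracket_Jmat_Phi_eq_0:
  assumes "X \<in> Phi ` hstar" "bracket Jmat X = 0"
  shows "X = Jmat"
  using assms(1)
proof (cases rule: Phi_hstar_cases)
  case (1 x y)
  have "x = 0" "(x\<^sup>2 + y\<^sup>2) / y = 1 / y"
    using assms(2) 1(1) by (auto simp: mat2_eq_iff bracket_nth 1(4) Jmat_def)
  then have "y = 1" using 1(1) by (simp add: power2_eq_1_iff)
  then show ?thesis using \<open>x = 0\<close> by (simp add: 1(4) Jmat_def)
qed

text \<open>Written through rotations so as to match the condition on components in
  \<open>edge_extremal\<close>.\<close>

definition ctrl_nth :: "ctrl \<Rightarrow> nat \<Rightarrow> real" where
  "ctrl_nth u j = fst ((ctrl_rot ^^ j) u)"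

text \<open>All indices from 2 on give the third vertex, so facts such as
  \<open>tform_Zmat_vertex_neg\<close> need no bound on j.\<close>

definition vertex :: "nat \<Rightarrow> ctrl" where
  "vertex j = (if j = 0 then (1, 0, 0) else if j = 1 then (0, 1, 0) else (0, 0, 1))"

lemma ctrl_nth_simps [simp]:
  "ctrl_nth (u0, u1, u2) 0 = u0" "ctrl_nth (u0, u1, u2) (Suc 0) = u1" "ctrl_nth (u0, u1, u2) 2 = u2"
  by (simp_all add: ctrl_nth_def numeral_2_eq_2)

section \<open>Barycentric coordinates on the control simplex\<close>

lemma less_3_cases: "j < 3 \<Longrightarrow> (j::nat) = 0 \<or> j = Suc 0 \<or> j = 2"
  by auto

lemma sum_lessThan_3: "(\<Sum>j<3. f j) = f 0 + f (Suc 0) + (f 2 :: 'a::comm_monoid_add)"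
  by (simp add: eval_nat_numeral)

lemma ctrl_nth_nonneg: "u \<in> UT \<Longrightarrow> j < 3 \<Longrightarrow> ctrl_nth u j \<ge> 0"
  by (cases u) (auto simp: UT_def dest!: less_3_cases)

lemma sum_ctrl_nth: "u \<in> UT \<Longrightarrow> (\<Sum>j<3. ctrl_nth u j) = 1"
  by (cases u) (auto simp: UT_def sum_lessThan_3)

lemma vertex_in_UT: "vertex j \<in> UT"
  by (auto simp: vertex_def UT_def)

lemma Zmat_eq_sum: "Zmat u = (\<Sum>j<3. ctrl_nth u j *\<^sub>R Zmat (vertex j))"
  by (cases u) (simp add: mat2_eq_iff vertex_def sum_lessThan_3 field_simps)

lemma tform_Zmat_vertex_neg:
  assumes "X \<in> Phi ` hstar"
  shows "tform X (Zmat (vertex j)) < 0"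
  using assms
proof (cases rule: Phi_hstar_cases)
  case (1 x y)
  \<comment> \<open>An opaque name for x / sqrt 3 makes the remaining inequalities linear in
    z.\<close>
  obtain z where z: "x / sqrt 3 = z" by blast
  have "\<bar>x / sqrt 3\<bar> < 1 / 3"
    using divide_strict_right_mono[OF 1(2), of "sqrt 3"] by (simp add: abs_divide)
  then have x: "\<bar>z\<bar> < 1 / 3"
    by (simp only: z)
  consider "j = 0" | "j = 1" | "j \<ge> 2" by linarith
  then show ?thesis
  proof cases
    assume "j = 0"
    then have "tform X (Zmat (vertex j)) = (1 / 3 - (x\<^sup>2 + y\<^sup>2)) / y"
      by (simp add: tform_eq 1(4) vertex_def diff_divide_distrib add_divide_distrib)
    then show ?thesis using 1 by (simp add: divide_neg_pos)
  next
    assume "j = 1"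
    then have "tform X (Zmat (vertex j)) = 2 * (z - 1 / 3) / y"
      using 1(1) by (simp add: tform_eq 1(4) vertex_def field_simps flip: z)
    then show ?thesis using 1(1) x by (simp only:) (intro divide_neg_pos, auto)
  next
    assume "j \<ge> 2"
    then have "tform X (Zmat (vertex j)) = 2 * (- z - 1 / 3) / y"
      using 1(1) by (simp add: tform_eq 1(4) vertex_def field_simps flip: z)
    then show ?thesis using 1(1) x by (simp only:) (intro divide_neg_pos, auto)
  qed
qed

lemma tform_Zmat_sum: "tform A (Zmat u) = (\<Sum>j<3. ctrl_nth u j * tform A (Zmat (vertex j)))"
  by (subst Zmat_eq_sum)
    (simp add: bounded_bilinear.sum_right[OF bounded_bilinear_tform]
      bounded_bilinear.scaleR_right[OF bounded_bilinear_tform])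

lemma tform_Zmat_le:
  assumes "u \<in> UT" "\<And>j. j < 3 \<Longrightarrow> tform X (Zmat (vertex j)) \<le> c"
  shows "tform X (Zmat u) \<le> c"
proof -
  have "tform X (Zmat u) \<le> (\<Sum>j<3. ctrl_nth u j * c)"
    unfolding tform_Zmat_sum[of X u] by (intro sum_mono mult_left_mono) (use assms ctrl_nth_nonneg in auto)
  also have "\<dots> = c" using sum_ctrl_nth[OF assms(1)] by (simp flip: sum_distrib_right)
  finally show ?thesis .
qed

lemma tform_Zmat_neg:
  assumes "X \<in> Phi ` hstar" "u \<in> UT"
  shows "tform X (Zmat u) < 0"
proof -
  define m where "m = Max ((\<lambda>j. tform X (Zmat (vertex j))) ` {..<3})"
  have "tform X (Zmat u) \<le> m"
    using assms(2) by (rule tform_Zmat_le) (auto simp: m_def)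
  also have "m < 0" unfolding m_def
    by (subst Max_less_iff) (auto simp: tform_Zmat_vertex_neg[OF assms(1)] lessThan_empty_iff)
  finally show ?thesis .
qed

definition switching :: "mat2 \<Rightarrow> mat2 \<Rightarrow> nat \<Rightarrow> real" where
  "switching X LR j = tform LR (Zmat (vertex j)) / tform X (Zmat (vertex j))"

text \<open>The maximal Hamiltonian corresponds to the minimal quotient m. This m is a mean of the
  vertex quotients, and a mean equal to a lower bound puts no weight on larger values.\<close>

lemma maximizer_ctrl_nth_eq_0:
  assumes X: "X \<in> Phi ` hstar" and u: "u \<in> UT"
    and max: "\<forall>v\<in>UT. Ham lc L1 X LR v \<le> Ham lc L1 X LR u"
    and ij: "i < 3" "j < 3" "switching X LR i < switching X LR j"
  shows "ctrl_nth u j = 0"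
proof -
  define n d where "n = (\<lambda>j. tform LR (Zmat (vertex j)))" and "d = (\<lambda>j. tform X (Zmat (vertex j)))"
  define m where "m = tform LR (Zmat u) / tform X (Zmat u)"
  have d: "d l < 0" for l by (simp add: d_def tform_Zmat_vertex_neg[OF X])
  have m: "m \<le> n l / d l" for l
    using max[rule_format, OF vertex_in_UT[of l]] by (simp add: Ham_def m_def n_def d_def)
  \<comment> \<open>The mean with denominators cleared: since d l < 0, the bound m \<le> n l / d l
    makes every summand nonnegative, so a zero sum kills each of them.\<close>
  have "(\<Sum>l<3. ctrl_nth u l * (m * d l - n l)) = m * tform X (Zmat u) - tform LR (Zmat u)"
    unfolding tform_Zmat_sum[of _ u]
    by (simp add: n_def d_def sum_distrib_left sum_subtractf algebra_simps)
  also have "\<dots> = 0" using tform_Zmat_neg[OF X u] by (simp add: m_def)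
  finally have "\<forall>l\<in>{..<3}. ctrl_nth u l * (m * d l - n l) = 0"
  proof (subst (asm) sum_nonneg_eq_0_iff)
    fix l :: nat assume "l \<in> {..<3}"
    then show "ctrl_nth u l * (m * d l - n l) \<ge> 0"
      using ctrl_nth_nonneg[OF u] m[of l] d[of l] by (intro mult_nonneg_nonneg) (auto simp: field_simps)
  qed auto
  then have "ctrl_nth u j = 0 \<or> m * d j = n j" using ij by auto
  moreover have "m * d j \<noteq> n j"
  proof
    assume "m * d j = n j"
    then have "n j / d j = m" using d[of j] by (simp add: field_simps)
    then show False using m[of i] ij(3) by (simp add: switching_def n_def d_def)
  qed
  ultimately show ?thesis by blast
qed

text \<open>If all three quotients equal c, then W - c X is orthogonal to the three vertex matrices,
  which span the trace-free matrices. Thus W = c X, and W orthogonal to X forces c = 0.\<close>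

lemma switching_all_equal:
  assumes X: "X \<in> Phi ` hstar" and W: "W \<in> sl2" "tform W X = 0"
    and eq: "\<And>i j. i < 3 \<Longrightarrow> j < 3 \<Longrightarrow> \<not> switching X W i < switching X W j"
  shows "W = 0"
proof -
  define c where "c = switching X W 0"
  define Y where "Y = W - c *\<^sub>R X"
  have "tform Y (Zmat (vertex j)) = 0" if "j < 3" for j
  proof -
    have "switching X W j = c" using eq[of 0 j] eq[of j 0] that by (simp add: c_def)
    then have "tform W (Zmat (vertex j)) = c * tform X (Zmat (vertex j))"
      using tform_Zmat_vertex_neg[OF X, of j] by (simp add: switching_def field_simps)
    then show ?thesis
      by (simp add: Y_def bounded_bilinear.diff_left[OF bounded_bilinear_tform]
          bounded_bilinear.scaleR_left[OF bounded_bilinear_tform])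
  qed
  note Z = this[unfolded vertex_def tform_eq]
  have "Y$2$1 / 3 + Y$1$2 = 0" "Y$1$1 * (1 / sqrt 3) - Y$2$1 * (2 / 3) - Y$2$2 * (1 / sqrt 3) = 0"
    "- (Y$1$1 * (1 / sqrt 3)) - Y$2$1 * (2 / 3) + Y$2$2 * (1 / sqrt 3) = 0"
    using Z[of 0] Z[of 1] Z[of 2] by simp_all
  then have "Y$2$1 = 0" "Y$1$2 = 0" "Y$1$1 * (1 / sqrt 3) = Y$2$2 * (1 / sqrt 3)"
    by linarith+
  moreover have "Y \<in> sl2" using W(1) Phi_in_sl2[OF X] by (simp add: Y_def sl2_iff algebra_simps)
  ultimately have "Y = 0" by (simp add: mat2_eq_iff sl2_iff)
  then have "W = c *\<^sub>R X" by (simp add: Y_def)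
  moreover from this have "c * tform X X = 0"
    using W(2) by (simp add: bounded_bilinear.scaleR_left[OF bounded_bilinear_tform])
  ultimately show ?thesis by (simp add: tform_Phi_self[OF X])
qed

section \<open>Expansion of the costate\<close>

text \<open>Limits at t0 along almost every time. They are needed because the vanishing of the
  Hamiltonian is known only almost everywhere.\<close>

definition ae_at :: "real \<Rightarrow> real \<Rightarrow> real \<Rightarrow> real filter" where
  "ae_at a b t0 = inf (at t0 within {a..b}) (ae_filter (lebesgue_on {a..b}))"

lemma eventually_ae_at:
  "eventually P (ae_at a b t0) \<longleftrightarrow>
     (\<exists>\<delta>>0. AE t in lebesgue_on {a..b}. t \<noteq> t0 \<and> \<bar>t - t0\<bar> < \<delta> \<longrightarrow> P t)" (is "?L \<longleftrightarrow> ?R")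
proof
  assume ?L
  then obtain Q R where Q: "eventually Q (at t0 within {a..b})" and R: "AE t in lebesgue_on {a..b}. R t"
    and QR: "\<And>t. Q t \<Longrightarrow> R t \<Longrightarrow> P t"
    unfolding ae_at_def eventually_inf by blast
  from Q obtain \<delta> where \<delta>: "\<delta> > 0" "\<And>t. t \<in> {a..b} \<Longrightarrow> t \<noteq> t0 \<Longrightarrow> \<bar>t - t0\<bar> < \<delta> \<Longrightarrow> Q t"
    unfolding eventually_at dist_real_def by blast
  have "AE t in lebesgue_on {a..b}. t \<in> {a..b}" by (auto intro!: AE_I2)
  with R have "AE t in lebesgue_on {a..b}. t \<noteq> t0 \<and> \<bar>t - t0\<bar> < \<delta> \<longrightarrow> P t"
    by eventually_elim (use \<delta> QR in blast)
  then show ?R using \<delta>(1) by blast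
next
  assume ?R
  then obtain \<delta> where \<delta>: "\<delta> > 0" "AE t in lebesgue_on {a..b}. t \<noteq> t0 \<and> \<bar>t - t0\<bar> < \<delta> \<longrightarrow> P t"
    by blast
  have "eventually (\<lambda>t. t \<noteq> t0 \<and> \<bar>t - t0\<bar> < \<delta>) (at t0 within {a..b})"
    unfolding eventually_at dist_real_def using \<delta>(1) by blast
  with \<delta>(2) show ?L unfolding ae_at_def eventually_inf by blast
qed

lemma ae_at_le: "ae_at a b t0 \<le> at t0 within {a..b}"
  by (simp add: ae_at_def)

lemma AE_eventually_ae_at: "AE t in lebesgue_on {a..b}. P t \<Longrightarrow> eventually P (ae_at a b t0)"
  unfolding ae_at_def by (erule filter_leD[OF inf_le2])

text \<open>Every punctured neighbourhood of t0 in [a,b] contains a nondegenerate interval, which is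
  not null. Limits along this filter are therefore unique.\<close>

lemma ae_at_neq_bot:
  assumes "a < b" "t0 \<in> {a..b}"
  shows "ae_at a b t0 \<noteq> bot"
proof
  assume "ae_at a b t0 = bot"
  then have "eventually (\<lambda>_. False) (ae_at a b t0)" by simp
  then obtain \<delta> where \<delta>: "\<delta> > 0" "AE t in lebesgue_on {a..b}. \<not> (t \<noteq> t0 \<and> \<bar>t - t0\<bar> < \<delta>)"
    unfolding eventually_ae_at by auto
  have "\<exists>c d. a \<le> c \<and> c < d \<and> d \<le> b \<and> (\<forall>t\<in>{c..d}. t \<noteq> t0 \<and> \<bar>t - t0\<bar> < \<delta>)"
  proof (cases "t0 < b")
    case True
    define h where "h = min \<delta> (b - t0)"
    have "h > 0" "h \<le> \<delta>" "h \<le> b - t0" using True \<delta>(1) by (auto simp: h_def)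
    then show ?thesis
      using assms by (intro exI[of _ "t0 + h / 3"] exI[of _ "t0 + h / 2"]) auto
  next
    case False
    define h where "h = min \<delta> (t0 - a)"
    have "h > 0" "h \<le> \<delta>" "h \<le> t0 - a" using False assms \<delta>(1) by (auto simp: h_def)
    then show ?thesis
      using assms by (intro exI[of _ "t0 - h / 2"] exI[of _ "t0 - h / 3"]) auto
  qed
  then obtain c d where cd: "a \<le> c" "c < d" "d \<le> b" "\<And>t. t \<in> {c..d} \<Longrightarrow> t \<noteq> t0 \<and> \<bar>t - t0\<bar> < \<delta>"
    by blast
  obtain t where "t \<in> {c..d}" "\<not> (t \<noteq> t0 \<and> \<bar>t - t0\<bar> < \<delta>)"
    using AE_lebesgue_on_obtain[OF AE_lebesgue_on_subinterval[OF \<delta>(2) cd(1,3)] cd(2)] by blast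
  then show False using cd(4) by blast
qed

text \<open>The limit form of \<open>solves_on_expansion\<close>. The hypothesis may ignore null
  sets, while the conclusion holds along all times, since f is an integral; this allows the lemma to
  be iterated.\<close>

lemma solves_on_tendsto:
  fixes f :: "real \<Rightarrow> 'a::banach"
  assumes f: "solves_on a b f F" and t0: "t0 \<in> {a..b}"
    and F: "((\<lambda>t. F t /\<^sub>R (t - t0) ^ k) \<longlongrightarrow> V) (ae_at a b t0)"
  shows "((\<lambda>t. (f t - f t0) /\<^sub>R (t - t0) ^ Suc k) \<longlongrightarrow> V /\<^sub>R Suc k) (at t0 within {a..b})"
proof (rule tendstoI)
  fix \<epsilon> :: real assume "\<epsilon> > 0"
  have ae: "\<exists>\<delta>>0. AE t in lebesgue_on {a..b}. \<bar>t - t0\<bar> < \<delta>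
        \<longrightarrow> norm (F t - (t - t0) ^ k *\<^sub>R V) \<le> e * \<bar>t - t0\<bar> ^ k" if "e > 0" for e
  proof -
    obtain \<delta> where \<delta>: "\<delta> > 0"
      "AE t in lebesgue_on {a..b}. t \<noteq> t0 \<and> \<bar>t - t0\<bar> < \<delta> \<longrightarrow> dist (F t /\<^sub>R (t - t0) ^ k) V < e"
      using tendstoD[OF F \<open>e > 0\<close>] unfolding eventually_ae_at by blast
    have "AE t in lebesgue_on {a..b}. t \<noteq> t0"
      unfolding AE_lebesgue_on_iff_negligible by (rule negligible_subset[of "{t0}"]) auto
    with \<delta>(2) have "AE t in lebesgue_on {a..b}. \<bar>t - t0\<bar> < \<delta>
        \<longrightarrow> norm (F t - (t - t0) ^ k *\<^sub>R V) \<le> e * \<bar>t - t0\<bar> ^ k"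
    proof eventually_elim
      case (elim t)
      show ?case
      proof
        assume "\<bar>t - t0\<bar> < \<delta>"
        then have "norm (F t /\<^sub>R (t - t0) ^ k - V) \<le> e" using elim by (simp add: dist_norm)
        then have "\<bar>t - t0\<bar> ^ k * norm (F t /\<^sub>R (t - t0) ^ k - V) \<le> \<bar>t - t0\<bar> ^ k * e"
          by (rule mult_left_mono) simp
        also have "\<bar>t - t0\<bar> ^ k * norm (F t /\<^sub>R (t - t0) ^ k - V)
            = norm ((t - t0) ^ k *\<^sub>R (F t /\<^sub>R (t - t0) ^ k - V))"
          by (simp add: power_abs)
        also have "(t - t0) ^ k *\<^sub>R (F t /\<^sub>R (t - t0) ^ k - V) = F t - (t - t0) ^ k *\<^sub>R V"
          using elim(2) by (simp add: scaleR_diff_right)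
        finally show "norm (F t - (t - t0) ^ k *\<^sub>R V) \<le> e * \<bar>t - t0\<bar> ^ k"
          by (simp add: mult.commute)
      qed
    qed
    then show ?thesis using \<delta>(1) by blast
  qed
  have "\<exists>\<delta>>0. \<forall>t\<in>{a..b}. \<bar>t - t0\<bar> < \<delta> \<longrightarrow>
      norm (f t - f t0 - ((t - t0) ^ Suc k / Suc k) *\<^sub>R V) \<le> \<epsilon> / 2 * \<bar>t - t0\<bar> ^ Suc k"
    by (rule solves_on_expansion[OF f t0 ae half_gt_zero[OF \<open>\<epsilon> > 0\<close>]])
  then obtain \<delta> where \<delta>: "\<delta> > 0" "\<And>t. t\<in>{a..b} \<Longrightarrow> \<bar>t - t0\<bar> < \<delta> \<Longrightarrow>
      norm (f t - f t0 - ((t - t0) ^ Suc k / Suc k) *\<^sub>R V) \<le> \<epsilon> / 2 * \<bar>t - t0\<bar> ^ Suc k"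
    by blast
  show "\<forall>\<^sub>F t in at t0 within {a..b}. dist ((f t - f t0) /\<^sub>R (t - t0) ^ Suc k) (V /\<^sub>R Suc k) < \<epsilon>"
    unfolding eventually_at
  proof (intro exI[of _ \<delta>] conjI ballI impI)
    fix t assume "t \<in> {a..b}" and t: "t \<noteq> t0 \<and> dist t t0 < \<delta>"
    define p where "p = (t - t0) ^ Suc k"
    have "p \<noteq> 0" using t by (simp add: p_def)
    have "(f t - f t0) /\<^sub>R p - V /\<^sub>R Suc k = (f t - f t0 - (p / Suc k) *\<^sub>R V) /\<^sub>R p"
      using \<open>p \<noteq> 0\<close> by (simp add: scaleR_diff_right inverse_eq_divide)
    then have "dist ((f t - f t0) /\<^sub>R p) (V /\<^sub>R Suc k) = norm (f t - f t0 - (p / Suc k) *\<^sub>R V) / \<bar>p\<bar>"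
      by (simp add: dist_norm divide_inverse_commute)
    also have "\<dots> \<le> (\<epsilon> / 2 * \<bar>p\<bar>) / \<bar>p\<bar>"
      using \<delta>(2)[OF \<open>t \<in> {a..b}\<close>] t by (intro divide_right_mono) (auto simp: p_def dist_real_def power_abs abs_mult)
    also have "\<dots> < \<epsilon>" using \<open>\<epsilon> > 0\<close> \<open>p \<noteq> 0\<close> by simp
    finally show "dist ((f t - f t0) /\<^sub>R (t - t0) ^ Suc k) (V /\<^sub>R Suc k) < \<epsilon>"
      by (simp only: p_def)
  qed fact
qed

section \<open>Boundedness of the control term\<close>

lemma norm_Zmat_le:
  assumes "u \<in> UT"
  shows "norm (Zmat u) \<le> (\<Sum>j<3. norm (Zmat (vertex j)))"
proof -
  have "ctrl_nth u j \<le> 1" if "j < 3" for j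
    using member_le_sum[of j "{..<3}" "ctrl_nth u"] ctrl_nth_nonneg[OF assms] sum_ctrl_nth[OF assms] that by simp
  then have "norm (ctrl_nth u j *\<^sub>R Zmat (vertex j)) \<le> norm (Zmat (vertex j))" if "j < 3" for j
    using ctrl_nth_nonneg[OF assms that] that by (simp add: mult_left_le_one_le)
  then show ?thesis
    by (subst Zmat_eq_sum) (intro order.trans[OF norm_sum sum_mono], auto)
qed

text \<open>The denominator at u is a convex combination of the three vertex denominators, and for X
  near X0 these stay below a common negative number, whatever the control does.\<close>

lemma Pctrl_bounded:
  assumes X: "(X \<longlongrightarrow> X0) F" and X0: "X0 \<in> Phi ` hstar" and u: "eventually (\<lambda>t. u t \<in> UT) F"
  shows "\<exists>C>0. eventually (\<lambda>t. norm (Pctrl (X t) (u t)) \<le> C) F"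
proof -
  define K where "K = (\<Sum>j<3. norm (Zmat (vertex j)))"
  have "K \<ge> 0" unfolding K_def by (intro sum_nonneg) auto
  \<comment> \<open>Half of the largest limit: all three limits are at most 2 m, hence strictly
    below the negative m.\<close>
  define m where "m = Max ((\<lambda>j. tform X0 (Zmat (vertex j))) ` {..<3}) / 2"
  have "m < 0" unfolding m_def
    using tform_Zmat_vertex_neg[OF X0] by (simp add: lessThan_empty_iff)
  have D: "eventually (\<lambda>t. tform (X t) (Zmat (vertex j)) < m) F" if "j < 3" for j
  proof (rule order_tendstoD(2))
    show "((\<lambda>t. tform (X t) (Zmat (vertex j))) \<longlongrightarrow> tform X0 (Zmat (vertex j))) F"
      by (rule bounded_bilinear.tendsto[OF bounded_bilinear_tform X tendsto_const])
    have "tform X0 (Zmat (vertex j)) \<le> 2 * m" unfolding m_def using that by simp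
    then show "tform X0 (Zmat (vertex j)) < m" using \<open>m < 0\<close> by linarith
  qed
  have "eventually (\<lambda>t. \<forall>j\<in>{..<3}. tform (X t) (Zmat (vertex j)) < m) F"
  proof (rule eventually_ball_finite[OF finite_lessThan], rule ballI)
    fix j :: nat assume "j \<in> {..<3}"
    then show "eventually (\<lambda>t. tform (X t) (Zmat (vertex j)) < m) F"
      using D by simp
  qed
  with u have "eventually (\<lambda>t. norm (Pctrl (X t) (u t)) \<le> K / - m + 1) F"
  proof eventually_elim
    case (elim t)
    have "tform (X t) (Zmat (u t)) \<le> m"
      by (rule tform_Zmat_le[OF elim(1)]) (use elim(2) in \<open>auto intro: less_imp_le\<close>)
    then have "norm (Pctrl (X t) (u t)) \<le> K / - m"
      using \<open>m < 0\<close> norm_Zmat_le[OF elim(1)] \<open>K \<ge> 0\<close>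
      by (simp only: Pctrl_def norm_scaleR tform_commute[of "Zmat _"] K_def[symmetric] real_norm_def
          abs_divide abs_one times_divide_eq_left mult_1) (intro frac_le, auto)
    then show ?case by simp
  qed
  moreover have "K / - m + 1 > 0" using \<open>K \<ge> 0\<close> \<open>m < 0\<close>
    by (intro add_nonneg_pos divide_nonneg_pos) auto
  ultimately show ?thesis by blast
qed

text \<open>The control enters the costate equation only through terms linear in LR. These are
  negligible at any order to which LR is already known to vanish, so -[M,X] determines the leading
  term; the exponents produced are 0, 1 and 2.\<close>

lemma costate_expansion:
  assumes ext: "pontryagin_extremal a b g X L1 LR lc u" and ab: "a < b" and t0: "t0 \<in> {a..b}"
    and nonsing: "(g t0, L1 t0, X t0, LR t0) \<notin> sing_locus"
  obtains k W where "W \<noteq> 0" "W \<in> sl2" "tform W (X t0) = 0"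
    "((\<lambda>t. LR t /\<^sub>R (t - t0) ^ k) \<longlongrightarrow> W) (at t0 within {a..b})"
proof -
  interpret tf: bounded_bilinear tform by (rule bounded_bilinear_tform)
  interpret br: bounded_bilinear bracket by (rule bounded_bilinear_bracket)
  let ?A = "at t0 within {a..b}" and ?L = "ae_at a b t0"
  have pt: "u t \<in> UT" "g t \<in> SL2" "X t \<in> Phi ` hstar" "L1 t \<in> sl2" "LR t \<in> sl2"
        "tform (LR t) (X t) = 0" "(lc, L1 t, LR t) \<noteq> 0" if "t \<in> {a..b}" for t
    using ext that unfolding pontryagin_extremal_def by blast+
  define P where "P = (\<lambda>t. Pctrl (X t) (u t))"
  define M where "M = (\<lambda>t. L1 t - (3 / 2 * lc) *\<^sub>R Jmat)"
  \<comment> \<open>The part of the costate equation that contains the control.\<close>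
  define E where "E = (\<lambda>t. bracket (P t) (LR t) - tform (LR t) (P t) *\<^sub>R bracket (P t) (X t))"
  have sX: "solves_on a b X (\<lambda>t. bracket (Pctrl (X t) (u t)) (X t))"
    and sL1: "solves_on a b L1 (\<lambda>t. bracket (L1 t) (X t))"
    and sLR0: "solves_on a b LR (\<lambda>t. let P = Pctrl (X t) (u t) in
        bracket P (LR t) - tform (LR t) P *\<^sub>R bracket P (X t)
          + bracket (- L1 t + (3 / 2 * lc) *\<^sub>R Jmat) (X t))"
    and "AE t in lebesgue_on {a..b}.
        (\<forall>v\<in>UT. Ham lc (L1 t) (X t) (LR t) v \<le> Ham lc (L1 t) (X t) (LR t) (u t)) \<and>
        Ham lc (L1 t) (X t) (LR t) (u t) = 0"
    using ext unfolding pontryagin_extremal_def by blast+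
  then have Ham0: "AE t in lebesgue_on {a..b}. Ham lc (L1 t) (X t) (LR t) (u t) = 0"
    by (elim eventually_mono conjunct2)
  have "- L1 t + (3 / 2 * lc) *\<^sub>R Jmat = - M t" for t by (simp add: M_def)
  then have sLR: "solves_on a b LR (\<lambda>t. E t - bracket (M t) (X t))"
    using sLR0 by (simp add: Let_def E_def P_def br.minus_left)
  have lim: "(f \<longlongrightarrow> f t0) ?A" if "solves_on a b f F" for f F :: "real \<Rightarrow> mat2"
    using solves_on_continuous[OF that] t0 by (simp add: continuous_on_def)
  note limX = lim[OF sX] and limL1 = lim[OF sL1] and limLR = lim[OF sLR]
  have limM: "(M \<longlongrightarrow> M t0) ?A" unfolding M_def by (intro tendsto_intros limL1)
  have "eventually (\<lambda>t. u t \<in> UT) ?A"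
    using pt(1) by (auto simp: eventually_at_filter)
  then obtain C where C: "C > 0" "eventually (\<lambda>t. norm (P t) \<le> C) ?A"
    using Pctrl_bounded[OF limX pt(3)[OF t0]] unfolding P_def by blast
  have Xb: "eventually (\<lambda>t. norm (X t) \<le> norm (X t0) + 1) ?A"
    using order_tendstoD(2)[OF tendsto_norm[OF limX], of "norm (X t0) + 1"]
    by (auto elim: eventually_mono)
  obtain Kb where Kb: "Kb > 0" "\<And>x y. norm (bracket x y) \<le> norm x * norm y * Kb"
    using br.pos_bounded by blast
  obtain Kt where Kt: "Kt > 0" "\<And>x y. norm (tform x y) \<le> norm x * norm y * Kt"
    using tf.pos_bounded by blast
  \<comment> \<open>The two terms of E are bounded by means of |P| \<le> C, |X| \<le> |X t0| + 1 and
    the constants Kb, Kt of the two bilinear maps.\<close>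
  define C' where "C' = C * Kb + C * Kt * (C * (norm (X t0) + 1) * Kb)"
  have Eb: "eventually (\<lambda>t. norm (E t) \<le> C' * norm (LR t)) ?A"
    using C(2) Xb
  proof eventually_elim
    case (elim t)
    have "norm (bracket (P t) (LR t)) \<le> norm (P t) * norm (LR t) * Kb" by (rule Kb)
    also have "\<dots> \<le> C * norm (LR t) * Kb"
      using elim Kb(1) by (intro mult_right_mono) auto
    finally have 1: "norm (bracket (P t) (LR t)) \<le> C * norm (LR t) * Kb" .
    have "norm (bracket (P t) (X t)) \<le> norm (P t) * norm (X t) * Kb" by (rule Kb)
    also have "\<dots> \<le> C * (norm (X t0) + 1) * Kb"
      using elim Kb(1) C(1) by (intro mult_right_mono mult_mono) auto
    finally have 2: "norm (bracket (P t) (X t)) \<le> C * (norm (X t0) + 1) * Kb" .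
    have "norm (tform (LR t) (P t)) \<le> norm (LR t) * norm (P t) * Kt" by (rule Kt)
    also have "\<dots> \<le> norm (LR t) * C * Kt"
      using elim Kt(1) by (intro mult_right_mono mult_left_mono) auto
    finally have "norm (tform (LR t) (P t) *\<^sub>R bracket (P t) (X t))
        \<le> (norm (LR t) * C * Kt) * (C * (norm (X t0) + 1) * Kb)"
      unfolding norm_scaleR real_norm_def[symmetric] using 2 C(1) Kt(1) by (intro mult_mono) auto
    with 1 have "norm (E t) \<le> C * norm (LR t) * Kb + (norm (LR t) * C * Kt) * (C * (norm (X t0) + 1) * Kb)"
      unfolding E_def by (intro order.trans[OF norm_triangle_ineq4] add_mono)
    then show ?case by (simp add: C'_def algebra_simps)
  qed
  have E_lim: "((\<lambda>t. E t /\<^sub>R (t - t0) ^ k) \<longlongrightarrow> 0) ?A" if "((\<lambda>t. LR t /\<^sub>R (t - t0) ^ k) \<longlongrightarrow> 0) ?A" for k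
  proof (rule Lim_null_comparison)
    show "eventually (\<lambda>t. norm (E t /\<^sub>R (t - t0) ^ k) \<le> C' * norm (LR t /\<^sub>R (t - t0) ^ k)) ?A"
      using Eb
    proof eventually_elim
      case (elim t)
      then have "norm (E t) * inverse \<bar>(t - t0) ^ k\<bar> \<le> (C' * norm (LR t)) * inverse \<bar>(t - t0) ^ k\<bar>"
        by (intro mult_right_mono) auto
      then show ?case by (simp add: mult_ac)
    qed
    show "((\<lambda>t. C' * norm (LR t /\<^sub>R (t - t0) ^ k)) \<longlongrightarrow> 0) ?A"
      by (intro tendsto_mult_right_zero tendsto_norm_zero that)
  qed
  show thesis
  proof (cases "LR t0 = 0")
    case False
    show thesis
      by (rule that[of "LR t0" 0]) (use False pt(5,6)[OF t0] limLR in simp_all)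
  next
    case LR0: True
    \<comment> \<open>H = 0 reads \<langle>M,X\<rangle> = \<langle>LR,P\<rangle>, whose right side
      tends to 0 with LR; by continuity M t0 is orthogonal to X t0.\<close>
    have "((\<lambda>t. tform (M t) (X t)) \<longlongrightarrow> 0) ?L"
    proof (rule Lim_null_comparison)
      show "eventually (\<lambda>t. norm (tform (M t) (X t)) \<le> Kt * C * norm (LR t)) ?L"
        using AE_eventually_ae_at[OF Ham0] filter_leD[OF ae_at_le C(2)]
      proof eventually_elim
        case (elim t)
        have "tform (LR t) (P t) = tform (LR t) (Zmat (u t)) / tform (X t) (Zmat (u t))"
          by (simp add: P_def Pctrl_def tf.scaleR_right tform_commute[of "Zmat _"])
        then have "tform (M t) (X t) = tform (LR t) (P t)"
          using elim(1) by (simp add: Ham_def M_def)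
        also have "norm \<dots> \<le> norm (LR t) * norm (P t) * Kt" by (rule Kt)
        also have "\<dots> \<le> norm (LR t) * C * Kt"
          using elim(2) Kt(1) by (intro mult_right_mono mult_left_mono) auto
        finally show ?case by (simp add: mult_ac)
      qed
      show "((\<lambda>t. Kt * C * norm (LR t)) \<longlongrightarrow> 0) ?L"
        using limLR LR0 by (intro tendsto_mult_right_zero tendsto_norm_zero) (auto intro: tendsto_mono[OF ae_at_le])
    qed
    moreover have "((\<lambda>t. tform (M t) (X t)) \<longlongrightarrow> tform (M t0) (X t0)) ?L"
      by (rule tendsto_mono[OF ae_at_le tf.tendsto[OF limM limX]])
    ultimately have MX: "tform (M t0) (X t0) = 0"
      using tendsto_unique[OF ae_at_neq_bot[OF ab t0]] by blast
    have "((\<lambda>t. E t - bracket (M t) (X t)) \<longlongrightarrow> 0 - bracket (M t0) (X t0)) ?A"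
      using E_lim[of 0] limLR LR0 by (intro tendsto_diff br.tendsto limM limX) simp
    then have F0: "((\<lambda>t. (E t - bracket (M t) (X t)) /\<^sub>R (t - t0) ^ 0) \<longlongrightarrow> - bracket (M t0) (X t0)) ?L"
      by (auto intro: tendsto_mono[OF ae_at_le])
    have LR1: "((\<lambda>t. LR t /\<^sub>R (t - t0) ^ 1) \<longlongrightarrow> - bracket (M t0) (X t0)) ?A"
      using solves_on_tendsto[OF sLR t0 F0] LR0 by simp
    have Msl2: "M t0 \<in> sl2"
      using pt(4)[OF t0] by (simp add: M_def sl2_iff Jmat_def)
    show thesis
    proof (cases "M t0 = 0")
      case False
      then have "bracket (M t0) (X t0) \<noteq> 0"
        using bracket_Phi_eq_0[OF Msl2 pt(3)[OF t0] MX] by blast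
      then show thesis
        using bracket_in_sl2[of "M t0" "X t0"] tform_bracket_right[of "M t0" "X t0"]
        by (intro that[OF _ _ _ LR1]) (simp_all add: tf.minus_left sl2_iff)
    next
      case M0: True
      then have L10: "L1 t0 = (3 / 2 * lc) *\<^sub>R Jmat" by (simp add: M_def)
      \<comment> \<open>With lc = 0 all multipliers would vanish at t0.\<close>
      have "lc \<noteq> 0" using pt(7)[OF t0] L10 LR0 by (auto simp: zero_prod_def)
      have "X t0 \<noteq> Jmat"
      proof
        assume "X t0 = Jmat"
        then have "(g t0, L1 t0, X t0, LR t0) \<in> sing_locus"
          using \<open>lc \<noteq> 0\<close> pt(2)[OF t0] L10 LR0 unfolding sing_locus_def by blast
        with nonsing show False by blast
      qed
      define V where "V = bracket (L1 t0) (X t0)"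
      have "bracket Jmat (X t0) \<noteq> 0"
        using bracket_Jmat_Phi_eq_0[OF pt(3)[OF t0]] \<open>X t0 \<noteq> Jmat\<close> by blast
      then have "V \<noteq> 0" using \<open>lc \<noteq> 0\<close> by (simp add: V_def L10 br.scaleR_left)
      moreover have "V \<in> sl2" "tform V (X t0) = 0"
        by (simp_all add: V_def bracket_in_sl2 tform_bracket_right)
      ultimately have VX: "bracket V (X t0) \<noteq> 0"
        using bracket_Phi_eq_0[OF _ pt(3)[OF t0]] by blast
      have "((\<lambda>t. bracket (L1 t) (X t) /\<^sub>R (t - t0) ^ 0) \<longlongrightarrow> V) ?L"
        using br.tendsto[OF limL1 limX] by (auto simp: V_def intro: tendsto_mono[OF ae_at_le])
      from solves_on_tendsto[OF sL1 t0 this]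
      \<comment> \<open>M and L1 differ by a constant and M vanishes at t0, so M grows like (t - t0)
        V.\<close>
      have "((\<lambda>t. M t /\<^sub>R (t - t0)) \<longlongrightarrow> V) ?A"
        by (simp add: M_def L10)
      then have "((\<lambda>t. bracket (M t /\<^sub>R (t - t0)) (X t)) \<longlongrightarrow> bracket V (X t0)) ?A"
        by (intro br.tendsto limX)
      then have "((\<lambda>t. E t /\<^sub>R (t - t0) ^ 1 - bracket (M t /\<^sub>R (t - t0)) (X t)) \<longlongrightarrow> 0 - bracket V (X t0)) ?A"
        using LR1 M0 by (intro tendsto_diff E_lim) (simp_all add: br.zero_left)
      then have "((\<lambda>t. (E t - bracket (M t) (X t)) /\<^sub>R (t - t0) ^ 1) \<longlongrightarrow> - bracket V (X t0)) ?L"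
        by (auto intro: tendsto_mono[OF ae_at_le] simp: br.scaleR_left scaleR_diff_right)
      from solves_on_tendsto[OF sLR t0 this]
      \<comment> \<open>The divisor \<open>Suc 1\<close> comes from integrating t - t0.\<close>
      have LR2: "((\<lambda>t. LR t /\<^sub>R (t - t0) ^ Suc 1) \<longlongrightarrow> - bracket V (X t0) /\<^sub>R Suc 1) ?A"
        using LR0 by simp
      then show thesis
        using VX bracket_in_sl2[of V "X t0"] tform_bracket_right[of V "X t0"]
        by (intro that[OF _ _ _ LR2]) (auto simp: tf.minus_left tf.scaleR_left sl2_iff)
    qed
  qed
qed

text \<open>After division by the k-th power of t - t0 the switching functions tend to those of W,
  which are not all equal, and a strict inequality between limits persists nearby. The power stays
  in the statement because its sign may differ on the two sides of t0.\<close>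

lemma switching_order:
  assumes ext: "pontryagin_extremal a b g X L1 LR lc u" and ab: "a < b" and t0: "t0 \<in> {a..b}"
    and nonsing: "(g t0, L1 t0, X t0, LR t0) \<notin> sing_locus"
  shows "\<exists>i<3. \<exists>j<3. \<exists>k. \<exists>\<delta>>0. \<forall>t\<in>{a..b}. t \<noteq> t0 \<and> \<bar>t - t0\<bar> < \<delta> \<longrightarrow>
       switching (X t) (LR t) i / (t - t0) ^ k < switching (X t) (LR t) j / (t - t0) ^ k"
proof -
  interpret tf: bounded_bilinear tform by (rule bounded_bilinear_tform)
  have X0: "X t0 \<in> Phi ` hstar" and sX: "solves_on a b X (\<lambda>t. bracket (Pctrl (X t) (u t)) (X t))"
    using ext t0 unfolding pontryagin_extremal_def by blast+
  obtain k W where W: "W \<noteq> 0" "W \<in> sl2" "tform W (X t0) = 0"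
    and lim: "((\<lambda>t. LR t /\<^sub>R (t - t0) ^ k) \<longlongrightarrow> W) (at t0 within {a..b})"
    using costate_expansion[OF assms] .
  have limX: "(X \<longlongrightarrow> X t0) (at t0 within {a..b})"
    using solves_on_continuous[OF sX] t0 by (simp add: continuous_on_def)
  have lim_sw: "((\<lambda>t. switching (X t) (LR t) l / (t - t0) ^ k) \<longlongrightarrow> switching (X t0) W l) (at t0 within {a..b})" for l
  proof -
    have "((\<lambda>t. tform (LR t /\<^sub>R (t - t0) ^ k) (Zmat (vertex l)) / tform (X t) (Zmat (vertex l)))
        \<longlongrightarrow> tform W (Zmat (vertex l)) / tform (X t0) (Zmat (vertex l))) (at t0 within {a..b})"
      using tform_Zmat_vertex_neg[OF X0, of l]
      by (intro tendsto_divide tf.tendsto lim limX tendsto_const) auto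
    then show ?thesis
      by (simp add: switching_def tf.scaleR_left divide_inverse mult_ac)
  qed
  obtain i j where ij: "i < 3" "j < 3" "switching (X t0) W i < switching (X t0) W j"
    using switching_all_equal[OF X0 W(2,3)] W(1) by blast
  have "eventually (\<lambda>t. 0 < switching (X t) (LR t) j / (t - t0) ^ k - switching (X t) (LR t) i / (t - t0) ^ k)
      (at t0 within {a..b})"
    by (rule order_tendstoD(1)[OF tendsto_diff[OF lim_sw lim_sw]]) (use ij in simp)
  then have "\<exists>\<delta>>0. \<forall>t\<in>{a..b}. t \<noteq> t0 \<and> \<bar>t - t0\<bar> < \<delta> \<longrightarrow>
       switching (X t) (LR t) i / (t - t0) ^ k < switching (X t) (LR t) j / (t - t0) ^ k"
    by (simp add: eventually_at dist_real_def)
  then show ?thesis using ij(1,2) by blast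
qed

text \<open>The larger switching function forces its control component to vanish almost everywhere,
  so edge-extremality applies on the whole of [c,d].\<close>

lemma bang_bang_if_switching_less:
  assumes ext: "pontryagin_extremal t1 t2 g X L1 LR lc u" and edge: "edge_extremal t1 t2 X u"
    and cd: "t1 \<le> c" "c < d" "d \<le> t2" and ij: "i < 3" "j < 3"
    and less: "\<And>t. \<lbrakk>c < t; t < d\<rbrakk> \<Longrightarrow> switching (X t) (LR t) i < switching (X t) (LR t) j"
  shows "ae_piecewise_const UT_vertices u c d"
proof (rule edge_extremal_bang_bang[OF edge ij(2) cd])
  have pt: "X t \<in> Phi ` hstar" "u t \<in> UT" if "t \<in> {t1..t2}" for t
    using ext that unfolding pontryagin_extremal_def by blast+
  have "AE t in lebesgue_on {t1..t2}.
        (\<forall>v\<in>UT. Ham lc (L1 t) (X t) (LR t) v \<le> Ham lc (L1 t) (X t) (LR t) (u t)) \<and>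
        Ham lc (L1 t) (X t) (LR t) (u t) = 0"
    using ext unfolding pontryagin_extremal_def by blast
  from AE_lebesgue_on_subinterval[OF this cd(1,3)]
  have "AE t in lebesgue_on {c..d}. t \<in> {c<..<d} \<longrightarrow> fst ((ctrl_rot ^^ j) (u t)) = 0"
  proof eventually_elim
    case (elim t)
    show ?case
    proof
      assume t: "t \<in> {c<..<d}"
      then have "t \<in> {t1..t2}" using cd by auto
      then show "fst ((ctrl_rot ^^ j) (u t)) = 0"
        using maximizer_ctrl_nth_eq_0[OF pt conjunct1[OF elim] ij less] t
        by (simp add: ctrl_nth_def)
    qed
  qed
  then show "AE t in lebesgue_on {c..d}. fst ((ctrl_rot ^^ j) (u t)) = 0"
    by (rule AE_lebesgue_on_interior)
qed

theorem theorem8p3p2: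
  fixes g X L1 LR :: "real \<Rightarrow> mat2" and lc :: real and u :: "real \<Rightarrow> ctrl" and t1 t2 :: real
  assumes "t1 \<le> t2"
    and "pontryagin_extremal t1 t2 g X L1 LR lc u"
    and "\<forall>t\<in>{t1..t2}. (g t, L1 t, X t, LR t) \<notin> sing_locus"
    and "edge_extremal t1 t2 X u"
  shows "\<exists>w. piecewise_const_on t1 t2 w \<and> (\<forall>t\<in>{t1..t2}. w t \<in> UT_vertices) \<and>
           (AE t in lebesgue_on {t1..t2}. u t = w t)"
proof -
  note ext = assms(2)
  have "ae_piecewise_const UT_vertices u t1 t2"
  proof (rule ae_piecewise_const_local)
    fix t0 assume t0: "t1 \<le> t0" "t0 < t2"
    then have "t1 < t2" and mem: "t0 \<in> {t1..t2}" by auto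
    obtain i j k \<delta> where ij: "i < 3" "j < 3" and \<delta>: "\<delta> > 0"
      "\<forall>t\<in>{t1..t2}. t \<noteq> t0 \<and> \<bar>t - t0\<bar> < \<delta> \<longrightarrow>
         switching (X t) (LR t) i / (t - t0) ^ k < switching (X t) (LR t) j / (t - t0) ^ k"
      using switching_order[OF ext \<open>t1 < t2\<close> mem bspec[OF assms(3) mem]] by blast
    show "\<exists>\<delta>>0. \<forall>d. t0 < d \<and> d \<le> t2 \<and> d < t0 + \<delta> \<longrightarrow> ae_piecewise_const UT_vertices u t0 d"
    proof (intro exI[of _ \<delta>] conjI allI impI)
      fix d assume d: "t0 < d \<and> d \<le> t2 \<and> d < t0 + \<delta>"
      have "switching (X t) (LR t) i < switching (X t) (LR t) j" if t: "t0 < t" "t < d" for t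
        using bspec[OF \<delta>(2), of t] t d t0 by (simp add: divide_less_cancel)
      then show "ae_piecewise_const UT_vertices u t0 d"
        using bang_bang_if_switching_less[OF ext assms(4) t0(1) _ _ ij] d by blast
    qed fact
  next
    fix t0 assume t0: "t1 < t0" "t0 \<le> t2"
    then have "t1 < t2" and mem: "t0 \<in> {t1..t2}" by auto
    obtain i j k \<delta> where ij: "i < 3" "j < 3" and \<delta>: "\<delta> > 0"
      "\<forall>t\<in>{t1..t2}. t \<noteq> t0 \<and> \<bar>t - t0\<bar> < \<delta> \<longrightarrow>
         switching (X t) (LR t) i / (t - t0) ^ k < switching (X t) (LR t) j / (t - t0) ^ k"
      using switching_order[OF ext \<open>t1 < t2\<close> mem bspec[OF assms(3) mem]] by blast
    show "\<exists>\<delta>>0. \<forall>c. c < t0 \<and> t1 \<le> c \<and> t0 - \<delta> < c \<longrightarrow> ae_piecewise_const UT_vertices u c t0"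
    proof (intro exI[of _ \<delta>] conjI allI impI)
      fix c assume c: "c < t0 \<and> t1 \<le> c \<and> t0 - \<delta> < c"
      have less: "switching (X t) (LR t) i / (t - t0) ^ k < switching (X t) (LR t) j / (t - t0) ^ k"
        if "c < t" "t < t0" for t
        using bspec[OF \<delta>(2), of t] that c t0 by simp
      show "ae_piecewise_const UT_vertices u c t0"
      \<comment> \<open>Left of t0 the power is negative for odd k, and then i and j exchange
        roles.\<close>
      proof (cases "even k")
        case True
        then have "switching (X t) (LR t) i < switching (X t) (LR t) j" if "c < t" "t < t0" for t
          using less[OF that] that by (simp add: divide_less_cancel zero_less_power_eq)
        then show ?thesis
          using bang_bang_if_switching_less[OF ext assms(4) _ _ t0(2) ij] c by blast
      next
        case False
        then have "switching (X t) (LR t) j < switching (X t) (LR t) i" if "c < t" "t < t0" for t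
          using less[OF that] that by (simp add: divide_less_cancel power_less_zero_eq)
        then show ?thesis
          using bang_bang_if_switching_less[OF ext assms(4) _ _ t0(2) ij(2,1)] c by blast
      qed
    qed fact
  qed (use assms(1) in \<open>auto simp: UT_vertices_def\<close>)
  then show ?thesis unfolding ae_piecewise_const_def .
qed

end
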